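(* Let $\Delta,\Gamma$ be finite simplicial complexes. If $\phi:\Delta\to\Gamma$ is a strongly connected simplicial map, then the image of $\phi^*:\mathcal{P}(\Gamma)\to\mathcal{P}(\Delta)$ is a face of the convex cone $\mathcal{P}(\Delta)$.
   Context: A simplicial complex $\Delta$ on a finite vertex set $V(\Delta)$ is a family of subsets of $V(\Delta)$ (called faces) that is closed under taking subsets and contains all singletons; its edges are its two-element faces. A simplicial map $\phi:\Delta\to\Gamma$ is a map $V(\Delta)\to V(\Gamma)$ taking faces to faces; it is surjective if every face of $\Gamma$ is the image $\phi(T)$ of some face $T\in\Delta$. Let $I(\Delta)\subseteq\mathbb{R}[x_i:i\in V(\Delta)]$ be the ideal generated by the monomials $\prod_{i\in S}x_i$ with $S\subseteq V(\Delta)$, $S\notin\Delta$, and let $R_2(\Delta)$ be the degree 2 homogeneous part of $\mathbb{R}[x_i:i\in V(\Delta)]/I(\Delta)$. Elements of $R_2(\Delta)$ are regarded as functions on $\mathcal{V}(\Delta)=\bigcup_{F\in\Delta}\operatorname{span}\{e_i:i\in F\}\subseteq\mathbb{R}^{V(\Delta)}$. Let $\mathcal{P}(\Delta)\subseteq R_2(\Delta)$ be the convex cone of quadratic forms that are nonnegative on $\mathcal{V}(\Delta)$. For a simplicial map $\phi:\Delta\to\Gamma$, $\phi^*:\mathcal{P}(\Gamma)\to\mathcal{P}(\Delta)$ is the pullback along the linear map $\mathcal{V}(\Delta)\to\mathcal{V}(\Gamma)$ induced by $e_i\mapsto e_{\phi(i)}$. A subset $S$ of a convex cone $C$ is a face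 of $C$ if $S$ is a convex cone and whenever $a,b\in C$ with $a+b\in S$, then $a,b\in S$. A surjective simplicial map $\phi:\Delta\to\Gamma$ is strongly connected if: (1) whenever $a,b\in V(\Delta)$ and $\phi(a)=\phi(b)=c\in V(\Gamma)$, there is a sequence $a=x_1,x_2,\dots,x_k=b$ in $V(\Delta)$ with $\phi(x_i)=c$ for all $i$ and $\{x_i,x_{i+1}\}\in\Delta$ for each $1\le i\le k-1$; (2) whenever $a,b$ are edges of $\Delta$ and $\phi(a)=\phi(b)=c$ is an edge of $\Gamma$, there is a sequence of edges $a=e_1,e_2,\dots,e_k=b$ of $\Delta$ with $\phi(e_i)=c$ for all $i$, and $e_i\cup e_{i+1}\in\Delta$ and $e_i\cap e_{i+1}\ne\varnothing$ for each $1\le i\le k-1$. *)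

theory Defs
  imports "HOL-Analysis.Analysis" "HOL-Analysis.Finite_Function_Topology" "HOL-Algebra.Algebra"
begin

subsection \<open>Simplicial complexes and simplicial maps\<close>

definition abstract_simplicial_complex :: "'a set \<Rightarrow> 'a set set \<Rightarrow> bool" where
  "abstract_simplicial_complex V \<Delta> \<longleftrightarrow>
     finite V \<and> \<Delta> \<subseteq> Pow V \<and> (\<forall>F\<in>\<Delta>. \<forall>G. G \<subseteq> F \<longrightarrow> G \<in> \<Delta>) \<and> (\<forall>v\<in>V. {v} \<in> \<Delta>)"

definition edges :: "'a set set \<Rightarrow> 'a set set" where
  "edges \<Delta> = {e \<in> \<Delta>. card e = 2}"

definition simplicial_map ::
    "'a set \<Rightarrow> 'a set set \<Rightarrow> 'b set \<Rightarrow> 'b set set \<Rightarrow> ('a \<Rightarrow> 'b) \<Rightarrow> bool" where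
  "simplicial_map V \<Delta> W \<Gamma> \<phi> \<longleftrightarrow> \<phi> ` V \<subseteq> W \<and> (\<forall>F\<in>\<Delta>. \<phi> ` F \<in> \<Gamma>)"

definition surjective_simplicial_map ::
    "'a set \<Rightarrow> 'a set set \<Rightarrow> 'b set \<Rightarrow> 'b set set \<Rightarrow> ('a \<Rightarrow> 'b) \<Rightarrow> bool" where
  "surjective_simplicial_map V \<Delta> W \<Gamma> \<phi> \<longleftrightarrow>
     simplicial_map V \<Delta> W \<Gamma> \<phi> \<and> (\<forall>F\<in>\<Gamma>. \<exists>T\<in>\<Delta>. F = \<phi> ` T)"

definition strongly_connected ::
    "'a set \<Rightarrow> 'a set set \<Rightarrow> 'b set \<Rightarrow> 'b set set \<Rightarrow> ('a \<Rightarrow> 'b) \<Rightarrow> bool" where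
  "strongly_connected V \<Delta> W \<Gamma> \<phi> \<longleftrightarrow>
     surjective_simplicial_map V \<Delta> W \<Gamma> \<phi> \<and>
     (\<forall>a\<in>V. \<forall>b\<in>V. \<forall>c\<in>W. \<phi> a = c \<and> \<phi> b = c \<longrightarrow>
        (\<exists>xs. xs \<noteq> [] \<and> hd xs = a \<and> last xs = b \<and> set xs \<subseteq> V \<and> (\<forall>x\<in>set xs. \<phi> x = c) \<and>
              successively (\<lambda>x y. {x, y} \<in> \<Delta>) xs)) \<and>
     (\<forall>a\<in>edges \<Delta>. \<forall>b\<in>edges \<Delta>. \<forall>c\<in>edges \<Gamma>. \<phi> ` a = c \<and> \<phi> ` b = c \<longrightarrow>
        (\<exists>es. es \<noteq> [] \<and> hd es = a \<and> last es = b \<and> set es \<subseteq> edges \<Delta> \<and> (\<forall>e\<in>set es. \<phi> ` e = c) \<and>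
              successively (\<lambda>e e'. e \<union> e' \<in> \<Delta> \<and> e \<inter> e' \<noteq> {}) es))"


subsection \<open>The Stanley--Reisner ring and its degree 2 part\<close>

text \<open>A monomial is a finitely supported exponent vector \<open>'a \<Rightarrow>\<^sub>0 nat\<close>; the type
  \<open>('a \<Rightarrow>\<^sub>0 nat) \<Rightarrow>\<^sub>0 real\<close> carries the usual polynomial multiplication (convolution).\<close>

type_synonym 'a rpoly = "('a \<Rightarrow>\<^sub>0 nat) \<Rightarrow>\<^sub>0 real"

definition mvar :: "'a \<Rightarrow> 'a rpoly" where
  "mvar i = Poly_Mapping.single (Poly_Mapping.single i 1) 1"

definition mconst :: "real \<Rightarrow> 'a rpoly" where
  "mconst c = Poly_Mapping.single 0 c"

definition mpoly_ring :: "'a set \<Rightarrow> 'a rpoly ring" where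
  "mpoly_ring V =
     \<lparr>carrier = {p. \<forall>m\<in>Poly_Mapping.keys p. Poly_Mapping.keys m \<subseteq> V},
      monoid.mult = (*), monoid.one = 1, ring.zero = 0, ring.add = (+)\<rparr>"

definition homogeneous :: "nat \<Rightarrow> 'a rpoly \<Rightarrow> bool" where
  "homogeneous d p \<longleftrightarrow>
     (\<forall>m\<in>Poly_Mapping.keys p. (\<Sum>i\<in>Poly_Mapping.keys m. Poly_Mapping.lookup m i) = d)"

definition SR_ideal :: "'a set \<Rightarrow> 'a set set \<Rightarrow> 'a rpoly set" where
  "SR_ideal V \<Delta> = Idl\<^bsub>mpoly_ring V\<^esub> {\<Prod>i\<in>S. mvar i | S. S \<subseteq> V \<and> S \<notin> \<Delta>}"

definition SR_ring :: "'a set \<Rightarrow> 'a set set \<Rightarrow> 'a rpoly set ring" where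
  "SR_ring V \<Delta> = mpoly_ring V Quot SR_ideal V \<Delta>"

definition SR_class :: "'a set \<Rightarrow> 'a set set \<Rightarrow> 'a rpoly \<Rightarrow> 'a rpoly set" where
  "SR_class V \<Delta> p = SR_ideal V \<Delta> +>\<^bsub>mpoly_ring V\<^esub> p"

definition R2 :: "'a set \<Rightarrow> 'a set set \<Rightarrow> 'a rpoly set set" where
  "R2 V \<Delta> = SR_class V \<Delta> ` {p \<in> carrier (mpoly_ring V). homogeneous 2 p}"

definition SR_scale :: "'a set \<Rightarrow> 'a set set \<Rightarrow> real \<Rightarrow> 'a rpoly set \<Rightarrow> 'a rpoly set" where
  "SR_scale V \<Delta> c f = SR_class V \<Delta> (mconst c) \<otimes>\<^bsub>SR_ring V \<Delta>\<^esub> f"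


subsection \<open>Elements of \<open>R2\<close> as functions\<close>

text \<open>Vectors of \<open>\<real>\<^sup>V\<close> are finitely supported functions \<open>'a \<Rightarrow>\<^sub>0 real\<close> with support in \<open>V\<close>, and the
  basis vector \<open>e\<^sub>i\<close> is \<open>Poly_Mapping.single i 1\<close>.\<close>

definition coord_variety :: "'a set set \<Rightarrow> ('a \<Rightarrow>\<^sub>0 real) set" where
  "coord_variety \<Delta> = (\<Union>F\<in>\<Delta>. span ((\<lambda>i. Poly_Mapping.single i 1) ` F))"

definition poly_eval :: "'a rpoly \<Rightarrow> ('a \<Rightarrow>\<^sub>0 real) \<Rightarrow> real" where
  "poly_eval p v = (\<Sum>m\<in>Poly_Mapping.keys p. Poly_Mapping.lookup p m *
     (\<Prod>i\<in>Poly_Mapping.keys m. Poly_Mapping.lookup v i ^ Poly_Mapping.lookup m i))"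

text \<open>The value of a residue class at a point of \<open>coord_variety \<Delta>\<close> is the common value of its
  representatives there (see \<open>SR_eval_class\<close> below).\<close>

definition SR_eval :: "'a rpoly set \<Rightarrow> ('a \<Rightarrow>\<^sub>0 real) \<Rightarrow> real" where
  "SR_eval f v = the_elem ((\<lambda>p. poly_eval p v) ` f)"

definition P_cone :: "'a set \<Rightarrow> 'a set set \<Rightarrow> 'a rpoly set set" where
  "P_cone V \<Delta> = {f \<in> R2 V \<Delta>. \<forall>v\<in>coord_variety \<Delta>. SR_eval f v \<ge> 0}"

text \<open>The linear map induced by \<open>e\<^sub>i \<mapsto> e\<^bsub>\<phi>(i)\<^esub>\<close>.\<close>

definition induced_map :: "('a \<Rightarrow> 'b) \<Rightarrow> ('a \<Rightarrow>\<^sub>0 real) \<Rightarrow> ('b \<Rightarrow>\<^sub>0 real)" where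
  "induced_map \<phi> v =
     (\<Sum>i\<in>Poly_Mapping.keys v. Poly_Mapping.lookup v i *\<^sub>R Poly_Mapping.single (\<phi> i) 1)"

text \<open>The pullback of \<open>f\<close> is the element of \<open>R2 V \<Delta>\<close> that, as a function on \<open>coord_variety \<Delta>\<close>,
  is \<open>f\<close> composed with the induced linear map; \<open>pullback_ex1\<close> below shows that this element
  exists and is unique.\<close>

definition pullback :: "'a set \<Rightarrow> 'a set set \<Rightarrow> ('a \<Rightarrow> 'b) \<Rightarrow> 'b rpoly set \<Rightarrow> 'a rpoly set" where
  "pullback V \<Delta> \<phi> f =
     (THE g. g \<in> R2 V \<Delta> \<and> (\<forall>v\<in>coord_variety \<Delta>. SR_eval g v = SR_eval f (induced_map \<phi> v)))"


subsection \<open>Convex cones in \<open>R2\<close> and their faces\<close>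

definition R2_convex_cone :: "'a set \<Rightarrow> 'a set set \<Rightarrow> 'a rpoly set set \<Rightarrow> bool" where
  "R2_convex_cone V \<Delta> C \<longleftrightarrow> C \<subseteq> R2 V \<Delta> \<and> C \<noteq> {} \<and>
     (\<forall>f\<in>C. \<forall>g\<in>C. f \<oplus>\<^bsub>SR_ring V \<Delta>\<^esub> g \<in> C) \<and>
     (\<forall>f\<in>C. \<forall>c\<ge>0. SR_scale V \<Delta> c f \<in> C)"

definition cone_face :: "'a set \<Rightarrow> 'a set set \<Rightarrow> 'a rpoly set set \<Rightarrow> 'a rpoly set set \<Rightarrow> bool" where
  "cone_face V \<Delta> S C \<longleftrightarrow> R2_convex_cone V \<Delta> C \<and> S \<subseteq> C \<and> R2_convex_cone V \<Delta> S \<and>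
     (\<forall>a\<in>C. \<forall>b\<in>C. a \<oplus>\<^bsub>SR_ring V \<Delta>\<^esub> b \<in> S \<longrightarrow> a \<in> S \<and> b \<in> S)"


subsection \<open>Well-definedness of evaluation and pullback\<close>

lemma carrier_mpoly_ring:
  "p \<in> carrier (mpoly_ring V) \<longleftrightarrow> (\<forall>m\<in>Poly_Mapping.keys p. Poly_Mapping.keys m \<subseteq> V)"
  by (simp add: mpoly_ring_def)

lemma keys_add_nat:
  fixes m n :: "'a \<Rightarrow>\<^sub>0 nat"
  shows "Poly_Mapping.keys (m + n) = Poly_Mapping.keys m \<union> Poly_Mapping.keys n"
  by (auto simp: in_keys_iff lookup_add)

lemma mpoly_ring_mult_closed:
  assumes "p \<in> carrier (mpoly_ring V)" "q \<in> carrier (mpoly_ring V)"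
  shows "p * q \<in> carrier (mpoly_ring V)"
  unfolding carrier_mpoly_ring
proof
  fix k assume "k \<in> Poly_Mapping.keys (p * q)"
  then obtain m n where "k = m + n" "m \<in> Poly_Mapping.keys p" "n \<in> Poly_Mapping.keys q"
    using keys_mult[of p q] by blast
  then show "Poly_Mapping.keys k \<subseteq> V"
    using assms by (simp add: carrier_mpoly_ring keys_add_nat)
qed

lemma mpoly_ring_add_closed:
  assumes "p \<in> carrier (mpoly_ring V)" "q \<in> carrier (mpoly_ring V)"
  shows "p + q \<in> carrier (mpoly_ring V)"
  using assms keys_add[of p q] unfolding carrier_mpoly_ring by blast

lemma mpoly_ring_uminus_closed:
  "p \<in> carrier (mpoly_ring V) \<Longrightarrow> - p \<in> carrier (mpoly_ring V)"
  by (simp add: carrier_mpoly_ring)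

lemma cring_mpoly_ring: "cring (mpoly_ring V)"
proof (rule cringI)
  show "abelian_group (mpoly_ring V)"
  proof (rule abelian_groupI)
    fix x assume x: "x \<in> carrier (mpoly_ring V)"
    show "\<exists>y\<in>carrier (mpoly_ring V). y \<oplus>\<^bsub>mpoly_ring V\<^esub> x = \<zero>\<^bsub>mpoly_ring V\<^esub>"
      by (rule bexI[OF _ mpoly_ring_uminus_closed[OF x]]) (simp add: mpoly_ring_def)
  next
    fix x y assume "x \<in> carrier (mpoly_ring V)" "y \<in> carrier (mpoly_ring V)"
    then show "x \<oplus>\<^bsub>mpoly_ring V\<^esub> y \<in> carrier (mpoly_ring V)"
      using mpoly_ring_add_closed[of x V y] by (simp add: mpoly_ring_def)
  qed (simp_all add: mpoly_ring_def add_ac)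
  show "comm_monoid (mpoly_ring V)"
  proof (rule comm_monoidI)
    fix x y assume "x \<in> carrier (mpoly_ring V)" "y \<in> carrier (mpoly_ring V)"
    then show "x \<otimes>\<^bsub>mpoly_ring V\<^esub> y \<in> carrier (mpoly_ring V)"
      using mpoly_ring_mult_closed[of x V y] by (simp add: mpoly_ring_def)
  qed (simp_all add: mpoly_ring_def mult_ac)
qed (simp add: mpoly_ring_def distrib_right)

lemma mpoly_ring_a_inv:
  assumes "p \<in> carrier (mpoly_ring V)" shows "\<ominus>\<^bsub>mpoly_ring V\<^esub> p = - p"
proof -
  interpret cring "mpoly_ring V" by (rule cring_mpoly_ring)
  show ?thesis
    by (rule minus_equality) (use assms mpoly_ring_uminus_closed in \<open>auto simp: mpoly_ring_def\<close>)
qed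

lemma rpoly_sum_monomials:
  "p = (\<Sum>m\<in>Poly_Mapping.keys p. Poly_Mapping.single m (Poly_Mapping.lookup p m))"
proof (rule poly_mapping_eqI)
  fix k
  show "Poly_Mapping.lookup p k = Poly_Mapping.lookup
    (\<Sum>m\<in>Poly_Mapping.keys p. Poly_Mapping.single m (Poly_Mapping.lookup p m)) k"
    by (simp add: lookup_sum lookup_single when_def in_keys_iff)
qed

lemma poly_eval_add: "poly_eval (p + q) v = poly_eval p v + poly_eval q v"
  unfolding poly_eval_def
  by (rule setsum_keys_plus_distrib) (simp_all add: distrib_right)

lemma poly_eval_0: "poly_eval 0 v = 0"
  by (simp add: poly_eval_def)

lemma poly_eval_sum: "poly_eval (sum f A) v = (\<Sum>a\<in>A. poly_eval (f a) v)"
  by (induction A rule: infinite_finite_induct) (simp_all add: poly_eval_add poly_eval_0)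

lemma poly_eval_uminus: "poly_eval (- p) v = - poly_eval p v"
  using poly_eval_add[of p "- p" v] by (simp add: poly_eval_0)

lemma poly_eval_diff: "poly_eval (p - q) v = poly_eval p v - poly_eval q v"
  using poly_eval_add[of p "- q" v] by (simp add: poly_eval_uminus)

definition mono_eval :: "('a \<Rightarrow>\<^sub>0 nat) \<Rightarrow> ('a \<Rightarrow>\<^sub>0 real) \<Rightarrow> real" where
  "mono_eval m v = (\<Prod>i\<in>Poly_Mapping.keys m. Poly_Mapping.lookup v i ^ Poly_Mapping.lookup m i)"

lemma mono_eval_superset:
  assumes "finite A" "Poly_Mapping.keys m \<subseteq> A"
  shows "mono_eval m v = (\<Prod>i\<in>A. Poly_Mapping.lookup v i ^ Poly_Mapping.lookup m i)"
  unfolding mono_eval_def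
  by (rule prod.mono_neutral_left) (use assms in \<open>auto simp: in_keys_iff\<close>)

lemma mono_eval_add: "mono_eval (m + n) v = mono_eval m v * mono_eval n v"
proof -
  let ?A = "Poly_Mapping.keys m \<union> Poly_Mapping.keys n"
  have "mono_eval m v = (\<Prod>i\<in>?A. Poly_Mapping.lookup v i ^ Poly_Mapping.lookup m i)"
    "mono_eval n v = (\<Prod>i\<in>?A. Poly_Mapping.lookup v i ^ Poly_Mapping.lookup n i)"
    "mono_eval (m + n) v = (\<Prod>i\<in>?A. Poly_Mapping.lookup v i ^ Poly_Mapping.lookup (m + n) i)"
    by (rule mono_eval_superset; simp add: keys_add_nat)+
  then show ?thesis
    by (simp add: lookup_add power_add prod.distrib)
qed

lemma poly_eval_single: "poly_eval (Poly_Mapping.single m c) v = c * mono_eval m v"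
  by (simp add: poly_eval_def mono_eval_def)

lemma poly_eval_alt:
  "poly_eval p v = (\<Sum>m\<in>Poly_Mapping.keys p. Poly_Mapping.lookup p m * mono_eval m v)"
  by (simp add: poly_eval_def mono_eval_def)

lemma poly_eval_mult: "poly_eval (p * q) v = poly_eval p v * poly_eval q v"
proof -
  have "poly_eval (p * q) v = poly_eval
     ((\<Sum>m\<in>Poly_Mapping.keys p. Poly_Mapping.single m (Poly_Mapping.lookup p m)) *
      (\<Sum>n\<in>Poly_Mapping.keys q. Poly_Mapping.single n (Poly_Mapping.lookup q n))) v"
    unfolding rpoly_sum_monomials[symmetric] ..
  also have "\<dots> = (\<Sum>m\<in>Poly_Mapping.keys p. \<Sum>n\<in>Poly_Mapping.keys q.
      (Poly_Mapping.lookup p m * mono_eval m v) * (Poly_Mapping.lookup q n * mono_eval n v))"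
    by (simp add: sum_product poly_eval_sum mult_single poly_eval_single mono_eval_add mult_ac)
  also have "\<dots> = poly_eval p v * poly_eval q v"
    by (simp add: sum_product poly_eval_alt)
  finally show ?thesis .
qed

definition nonface_polys :: "'a set \<Rightarrow> 'a set set \<Rightarrow> 'a rpoly set" where
  "nonface_polys V \<Delta> =
     {p. \<forall>m\<in>Poly_Mapping.keys p. Poly_Mapping.keys m \<subseteq> V \<and> Poly_Mapping.keys m \<notin> \<Delta>}"

lemma nonface_mult:
  assumes "abstract_simplicial_complex V \<Delta>" "p \<in> nonface_polys V \<Delta>" "q \<in> carrier (mpoly_ring V)"
  shows "p * q \<in> nonface_polys V \<Delta>"
  unfolding nonface_polys_def
proof (intro CollectI ballI conjI notI)
  fix k assume "k \<in> Poly_Mapping.keys (p * q)"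
  then obtain m n where k: "k = m + n" "m \<in> Poly_Mapping.keys p" "n \<in> Poly_Mapping.keys q"
    using keys_mult[of p q] by blast
  have m: "Poly_Mapping.keys m \<subseteq> V" "Poly_Mapping.keys m \<notin> \<Delta>"
    using assms(2) k(2) unfolding nonface_polys_def by blast+
  have n: "Poly_Mapping.keys n \<subseteq> V"
    using assms(3) k(3) unfolding carrier_mpoly_ring by blast
  show "Poly_Mapping.keys k \<subseteq> V"
    unfolding k(1) keys_add_nat using m(1) n by blast
  assume "Poly_Mapping.keys k \<in> \<Delta>"
  then have "Poly_Mapping.keys m \<in> \<Delta>"
    using assms(1) unfolding k(1) abstract_simplicial_complex_def keys_add_nat by blast
  then show False using m(2) by blast
qed

lemma ideal_nonface_polys:
  assumes "abstract_simplicial_complex V \<Delta>"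
  shows "ideal (nonface_polys V \<Delta>) (mpoly_ring V)"
proof -
  interpret cring "mpoly_ring V" by (rule cring_mpoly_ring)
  have sub: "nonface_polys V \<Delta> \<subseteq> carrier (mpoly_ring V)"
    by (auto simp: nonface_polys_def carrier_mpoly_ring)
  show ?thesis
  proof (rule idealI)
    show "ring (mpoly_ring V)" by (rule ring_axioms)
    show "subgroup (nonface_polys V \<Delta>) (add_monoid (mpoly_ring V))"
    proof (rule add.subgroupI)
      show "nonface_polys V \<Delta> \<subseteq> carrier (mpoly_ring V)" by (rule sub)
      have "0 \<in> nonface_polys V \<Delta>" by (simp add: nonface_polys_def)
      then show "nonface_polys V \<Delta> \<noteq> {}" by blast
      show "\<ominus>\<^bsub>mpoly_ring V\<^esub> a \<in> nonface_polys V \<Delta>" if "a \<in> nonface_polys V \<Delta>" for a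
      proof -
        have "\<ominus>\<^bsub>mpoly_ring V\<^esub> a = - a" using that sub by (intro mpoly_ring_a_inv) blast
        then show ?thesis using that by (simp add: nonface_polys_def)
      qed
      show "a \<oplus>\<^bsub>mpoly_ring V\<^esub> b \<in> nonface_polys V \<Delta>"
        if "a \<in> nonface_polys V \<Delta>" "b \<in> nonface_polys V \<Delta>" for a b
        using that keys_add[of a b] unfolding nonface_polys_def mpoly_ring_def by auto
    qed
  qed (use nonface_mult[OF assms] in \<open>auto simp: mpoly_ring_def mult.commute\<close>)
qed

lemma prod_mvar: "(\<Prod>i\<in>S. mvar i) = Poly_Mapping.single (\<Sum>i\<in>S. Poly_Mapping.single i 1) 1"
  by (induction S rule: infinite_finite_induct) (simp_all add: mvar_def mult_single)

lemma keys_sum_single: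
  "finite S \<Longrightarrow> Poly_Mapping.keys (\<Sum>i\<in>S. Poly_Mapping.single i (1::nat)) = S"
  by (induction S rule: finite_induct) (simp_all add: keys_add_nat)

lemma SR_ideal_eq:
  assumes "abstract_simplicial_complex V \<Delta>"
  shows "SR_ideal V \<Delta> = nonface_polys V \<Delta>"
proof -
  interpret cring "mpoly_ring V" by (rule cring_mpoly_ring)
  let ?G = "{\<Prod>i\<in>S. mvar i | S. S \<subseteq> V \<and> S \<notin> \<Delta>}"
  have finV: "finite V" using assms by (simp add: abstract_simplicial_complex_def)
  have gen: "?G \<subseteq> nonface_polys V \<Delta>"
  proof safe
    fix S assume S: "S \<subseteq> V" "S \<notin> \<Delta>"
    have "Poly_Mapping.keys (\<Sum>i\<in>S. Poly_Mapping.single i (1::nat)) = S"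
      by (rule keys_sum_single[OF finite_subset[OF S(1) finV]])
    then show "(\<Prod>i\<in>S. mvar i) \<in> nonface_polys V \<Delta>"
      using S by (simp add: nonface_polys_def prod_mvar)
  qed
  moreover have "nonface_polys V \<Delta> \<subseteq> carrier (mpoly_ring V)"
    by (auto simp: nonface_polys_def carrier_mpoly_ring)
  ultimately have "?G \<subseteq> carrier (mpoly_ring V)"
    by (rule subset_trans)
  then have id: "ideal (SR_ideal V \<Delta>) (mpoly_ring V)" and G: "?G \<subseteq> SR_ideal V \<Delta>"
    unfolding SR_ideal_def by (rule genideal_ideal, rule genideal_self)
  interpret I: ideal "SR_ideal V \<Delta>" "mpoly_ring V" by (rule id)
  have single: "Poly_Mapping.single m c \<in> SR_ideal V \<Delta>"
    if m: "Poly_Mapping.keys m \<subseteq> V" "Poly_Mapping.keys m \<notin> \<Delta>" for m c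
  proof -
    define s where "s = (\<Sum>i\<in>Poly_Mapping.keys m. Poly_Mapping.single i (1::nat))"
    have ls: "Poly_Mapping.lookup s k = (if k \<in> Poly_Mapping.keys m then 1 else 0)" for k
      by (simp add: s_def lookup_sum lookup_single when_def)
    have ms: "m = (m - s) + s"
      by (rule poly_mapping_eqI) (auto simp: lookup_add lookup_minus ls in_keys_iff)
    then have "Poly_Mapping.keys (m - s) \<subseteq> Poly_Mapping.keys m"
      by (metis keys_add_nat Un_upper1)
    then have "Poly_Mapping.single (m - s) c \<in> carrier (mpoly_ring V)"
      using m by (auto simp: carrier_mpoly_ring split: if_splits)
    moreover have "(\<Prod>i\<in>Poly_Mapping.keys m. mvar i) \<in> SR_ideal V \<Delta>"
      using G m by blast
    ultimately have "Poly_Mapping.single (m - s) c * (\<Prod>i\<in>Poly_Mapping.keys m. mvar i) \<in> SR_ideal V \<Delta>"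
      using I.I_l_closed by (fastforce simp: mpoly_ring_def)
    also have "Poly_Mapping.single (m - s) c * (\<Prod>i\<in>Poly_Mapping.keys m. mvar i)
        = Poly_Mapping.single ((m - s) + s) c"
      by (simp add: prod_mvar mult_single s_def)
    finally show ?thesis unfolding ms[symmetric] .
  qed
  have zero: "0 \<in> SR_ideal V \<Delta>"
    using I.zero_closed by (simp add: mpoly_ring_def)
  have add: "a + b \<in> SR_ideal V \<Delta>" if "a \<in> SR_ideal V \<Delta>" "b \<in> SR_ideal V \<Delta>" for a b
    using I.a_closed[OF that] by (simp add: mpoly_ring_def)
  have sum: "(\<And>a. a \<in> A \<Longrightarrow> f a \<in> SR_ideal V \<Delta>) \<Longrightarrow> sum f A \<in> SR_ideal V \<Delta>"
    if "finite A" for A :: "('a \<Rightarrow>\<^sub>0 nat) set" and f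
    using that by (induction A rule: finite_induct) (auto simp: zero add)
  have "nonface_polys V \<Delta> \<subseteq> SR_ideal V \<Delta>"
  proof
    fix p assume "p \<in> nonface_polys V \<Delta>"
    then have "(\<Sum>m\<in>Poly_Mapping.keys p. Poly_Mapping.single m (Poly_Mapping.lookup p m))
        \<in> SR_ideal V \<Delta>"
      by (intro sum single) (auto simp: nonface_polys_def)
    then show "p \<in> SR_ideal V \<Delta>" unfolding rpoly_sum_monomials[symmetric] .
  qed
  moreover have "SR_ideal V \<Delta> \<subseteq> nonface_polys V \<Delta>"
    unfolding SR_ideal_def
    by (rule genideal_minimal[OF ideal_nonface_polys[OF assms] gen])
  ultimately show ?thesis by blast
qed

lemma lookup_scaleR_real:
  "Poly_Mapping.lookup (c *\<^sub>R v) i = c * Poly_Mapping.lookup (v :: 'a \<Rightarrow>\<^sub>0 real) i"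
proof -
  have "finite {i. c *\<^sub>R Poly_Mapping.lookup v i \<noteq> 0}"
    by (rule finite_subset[OF _ finite_keys[of v]]) (auto simp: in_keys_iff)
  then show ?thesis by (simp add: scaleR_poly_mapping_def lookup_Abs_poly_mapping)
qed

lemma coord_variety_iff:
  assumes "abstract_simplicial_complex V \<Delta>"
  shows "v \<in> coord_variety \<Delta> \<longleftrightarrow> Poly_Mapping.keys v \<in> \<Delta>"
proof
  assume "v \<in> coord_variety \<Delta>"
  then obtain F where F: "F \<in> \<Delta>" "v \<in> span ((\<lambda>i. Poly_Mapping.single i 1) ` F)"
    by (auto simp: coord_variety_def)
  have "Poly_Mapping.keys v \<subseteq> F"
    using F(2)
  proof (induction rule: span_induct_alt)
    case base
    then show ?case by simp
  next
    case (step c x y)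
    then show ?case
      using keys_add[of "c *\<^sub>R x" y]
      by (auto simp: in_keys_iff lookup_add lookup_scaleR_real lookup_single when_def
          split: if_splits)
  qed
  then show "Poly_Mapping.keys v \<in> \<Delta>"
    using F(1) assms unfolding abstract_simplicial_complex_def by blast
next
  assume k: "Poly_Mapping.keys v \<in> \<Delta>"
  have "v = (\<Sum>i\<in>Poly_Mapping.keys v. Poly_Mapping.lookup v i *\<^sub>R Poly_Mapping.single i 1)"
    by (rule poly_mapping_eqI)
      (simp add: lookup_sum lookup_single when_def in_keys_iff lookup_scaleR_real
         if_distrib[where f = "\<lambda>x. _ * x"] sum.delta cong: if_cong)
  also have "\<dots> \<in> span ((\<lambda>i. Poly_Mapping.single i 1) ` Poly_Mapping.keys v)"
    by (intro span_sum span_scale span_base) auto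
  finally show "v \<in> coord_variety \<Delta>" using k by (auto simp: coord_variety_def)
qed

lemma poly_eval_nonface:
  assumes "abstract_simplicial_complex V \<Delta>" "h \<in> nonface_polys V \<Delta>" "v \<in> coord_variety \<Delta>"
  shows "poly_eval h v = 0"
  unfolding poly_eval_alt
proof (rule sum.neutral, rule ballI)
  fix m assume "m \<in> Poly_Mapping.keys h"
  then have "Poly_Mapping.keys m \<notin> \<Delta>" using assms(2) by (auto simp: nonface_polys_def)
  moreover have "Poly_Mapping.keys v \<in> \<Delta>" using assms coord_variety_iff by blast
  ultimately obtain i where i: "i \<in> Poly_Mapping.keys m" "i \<notin> Poly_Mapping.keys v"
    using assms(1) unfolding abstract_simplicial_complex_def by (meson subsetI)
  then have "Poly_Mapping.lookup v i ^ Poly_Mapping.lookup m i = 0"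
    by (simp add: in_keys_iff)
  then have "mono_eval m v = 0"
    unfolding mono_eval_def using i(1) by (meson finite_keys prod_zero)
  then show "Poly_Mapping.lookup h m * mono_eval m v = 0" by simp
qed

lemma SR_class_eq:
  assumes "abstract_simplicial_complex V \<Delta>"
  shows "SR_class V \<Delta> p = (\<lambda>h. h + p) ` nonface_polys V \<Delta>"
  by (auto simp: SR_class_def SR_ideal_eq[OF assms] a_r_coset_def' mpoly_ring_def)

lemma zero_nonface: "0 \<in> nonface_polys V \<Delta>"
  by (simp add: nonface_polys_def)

lemma SR_eval_class:
  assumes "abstract_simplicial_complex V \<Delta>" "v \<in> coord_variety \<Delta>"
  shows "SR_eval (SR_class V \<Delta> p) v = poly_eval p v"
proof -
  have "(\<lambda>q. poly_eval q v) ` SR_class V \<Delta> p = {poly_eval p v}"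
    unfolding SR_class_eq[OF assms(1)] image_image
    using poly_eval_nonface[OF assms(1) _ assms(2)] zero_nonface[of V \<Delta>]
    by (auto simp: poly_eval_add image_iff)
  then show ?thesis by (simp add: SR_eval_def)
qed

lemma SR_class_eqI:
  assumes sc: "abstract_simplicial_complex V \<Delta>" and pq: "p - q \<in> nonface_polys V \<Delta>"
  shows "SR_class V \<Delta> p = SR_class V \<Delta> q"
proof -
  have add: "a + b \<in> nonface_polys V \<Delta>"
    if "a \<in> nonface_polys V \<Delta>" "b \<in> nonface_polys V \<Delta>" for a b
    using that keys_add[of a b] unfolding nonface_polys_def by blast
  have "q - p \<in> nonface_polys V \<Delta>"
    using pq keys_minus[of "p - q"] by (simp add: nonface_polys_def)
  then have "h + q \<in> (\<lambda>h. h + p) ` nonface_polys V \<Delta>" if "h \<in> nonface_polys V \<Delta>" for h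
    using add[OF that, of "q - p"] by (intro image_eqI[where x = "h + (q - p)"]) auto
  moreover have "h + p \<in> (\<lambda>h. h + q) ` nonface_polys V \<Delta>" if "h \<in> nonface_polys V \<Delta>" for h
    using add[OF that pq] by (intro image_eqI[where x = "h + (p - q)"]) auto
  ultimately show ?thesis unfolding SR_class_eq[OF sc] by blast
qed

lemma degree2_determined_by_keys:
  fixes m n :: "'a \<Rightarrow>\<^sub>0 nat"
  assumes m: "(\<Sum>i\<in>Poly_Mapping.keys m. Poly_Mapping.lookup m i) = 2"
    and n: "(\<Sum>i\<in>Poly_Mapping.keys n. Poly_Mapping.lookup n i) = 2"
    and eq: "Poly_Mapping.keys m = Poly_Mapping.keys n"
  shows "m = n"
proof (rule poly_mapping_eqI)
  fix k
  let ?K = "Poly_Mapping.keys m"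
  have pos: "Poly_Mapping.lookup m i \<ge> 1" "Poly_Mapping.lookup n i \<ge> 1" if "i \<in> ?K" for i
    using that eq by (auto simp: in_keys_iff Suc_le_eq)
  have "k \<in> ?K \<Longrightarrow> Poly_Mapping.lookup m k = Poly_Mapping.lookup n k"
  proof -
    assume k: "k \<in> ?K"
    have dec: "(\<Sum>i\<in>?K. g i) = g k + (\<Sum>i\<in>?K - {k}. g i)" for g :: "'a \<Rightarrow> nat"
      using k by (simp add: sum.remove)
    show ?thesis
    proof (cases "?K - {k} = {}")
      case True
      then have "(\<Sum>i\<in>?K - {k}. g i) = 0" for g :: "'a \<Rightarrow> nat" by (metis sum.empty)
      from this[of "Poly_Mapping.lookup m"] this[of "Poly_Mapping.lookup n"] show ?thesis
        using m n[folded eq] dec[of "Poly_Mapping.lookup m"] dec[of "Poly_Mapping.lookup n"] by linarith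
    next
      case False
      then obtain j where j: "j \<in> ?K - {k}" by blast
      have "1 \<le> (\<Sum>i\<in>?K - {k}. Poly_Mapping.lookup m i)" "1 \<le> (\<Sum>i\<in>?K - {k}. Poly_Mapping.lookup n i)"
        using pos[of j] j member_le_sum[of j "?K - {k}" "Poly_Mapping.lookup m"]
          member_le_sum[of j "?K - {k}" "Poly_Mapping.lookup n"] by auto
      then show ?thesis
        using m n eq dec[of "Poly_Mapping.lookup m"] dec[of "Poly_Mapping.lookup n"] pos[OF k] by simp
    qed
  qed
  then show "Poly_Mapping.lookup m k = Poly_Mapping.lookup n k"
    using eq by (metis not_in_keys_iff_lookup_eq_zero)
qed

lemma homogeneous2_vanishing:
  assumes sc: "abstract_simplicial_complex V \<Delta>" and p: "p \<in> carrier (mpoly_ring V)" "homogeneous 2 p"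
    and van: "\<And>v. v \<in> coord_variety \<Delta> \<Longrightarrow> poly_eval p v = 0"
  shows "p \<in> nonface_polys V \<Delta>"
proof -
  define c where "c S = (\<Sum>k | k \<in> Poly_Mapping.keys p \<and> Poly_Mapping.keys k = S. Poly_Mapping.lookup p k)" for S
  have down: "G \<in> \<Delta>" if "F \<in> \<Delta>" "G \<subseteq> F" for F G
    using sc that unfolding abstract_simplicial_complex_def by blast
  have fin: "finite F" if "F \<in> \<Delta>" for F
    using sc that unfolding abstract_simplicial_complex_def by (meson PowD finite_subset subsetD)
  have sub: "(\<Sum>S\<in>Pow F. c S) = 0" if F: "F \<in> \<Delta>" for F
  proof -
    define v :: "'a \<Rightarrow>\<^sub>0 real" where "v = (\<Sum>i\<in>F. Poly_Mapping.single i 1)"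
    have lv: "Poly_Mapping.lookup v i = (if i \<in> F then 1 else 0)" for i
      using fin[OF F] by (simp add: v_def lookup_sum lookup_single when_def)
    have "Poly_Mapping.keys v = F" by (auto simp: in_keys_iff lv split: if_splits)
    then have "v \<in> coord_variety \<Delta>" using F coord_variety_iff[OF sc] by simp
    then have "0 = poly_eval p v" using van by simp
    also have "\<dots> = (\<Sum>k\<in>Poly_Mapping.keys p. if Poly_Mapping.keys k \<subseteq> F then Poly_Mapping.lookup p k else 0)"
      unfolding poly_eval_alt
    proof (rule sum.cong)
      fix k
      show "Poly_Mapping.lookup p k * mono_eval k v =
        (if Poly_Mapping.keys k \<subseteq> F then Poly_Mapping.lookup p k else 0)"
      proof (cases "Poly_Mapping.keys k \<subseteq> F")
        case True
        then have "mono_eval k v = 1"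
          unfolding mono_eval_def by (intro prod.neutral) (auto simp: lv)
        with True show ?thesis by simp
      next
        case False
        then obtain i where i: "i \<in> Poly_Mapping.keys k" "i \<notin> F" by blast
        then have "Poly_Mapping.lookup v i ^ Poly_Mapping.lookup k i = 0"
          by (simp add: lv in_keys_iff)
        then have "mono_eval k v = 0"
          unfolding mono_eval_def using i(1) by (meson finite_keys prod_zero)
        with False show ?thesis by simp
      qed
    qed simp
    also have "\<dots> = (\<Sum>k | k \<in> Poly_Mapping.keys p \<and> Poly_Mapping.keys k \<in> Pow F. Poly_Mapping.lookup p k)"
      by (simp add: sum.inter_filter)
    also have "\<dots> = (\<Sum>S\<in>Pow F. c S)"
      unfolding c_def
      by (subst sum.group[symmetric, where g = Poly_Mapping.keys and T = "Pow F"])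
        (use fin[OF F] in \<open>auto intro!: sum.cong\<close>)
    finally show ?thesis by simp
  qed
  have c0: "F \<in> \<Delta> \<Longrightarrow> c F = 0" for F
  proof (induction "card F" arbitrary: F rule: less_induct)
    case less
    have "c S = 0" if "S \<in> Pow F - {F}" for S
      using that less down[OF less.prems, of S] psubset_card_mono[OF fin[OF less.prems], of S] by blast
    then have "(\<Sum>S\<in>Pow F. c S) = c F"
      using fin[OF less.prems] by (subst sum.remove[of _ F]) auto
    then show ?case using sub[OF less.prems] by simp
  qed
  show ?thesis
    unfolding nonface_polys_def
  proof (intro CollectI ballI conjI notI)
    fix m assume m: "m \<in> Poly_Mapping.keys p"
    show "Poly_Mapping.keys m \<subseteq> V" using m p(1) by (simp add: carrier_mpoly_ring)
    assume face: "Poly_Mapping.keys m \<in> \<Delta>"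
    have "{k. k \<in> Poly_Mapping.keys p \<and> Poly_Mapping.keys k = Poly_Mapping.keys m} = {m}"
      using m p(2) degree2_determined_by_keys unfolding homogeneous_def by blast
    then have "c (Poly_Mapping.keys m) = Poly_Mapping.lookup p m" by (simp add: c_def)
    then show False using c0[OF face] m by (simp add: in_keys_iff)
  qed
qed

lemma mpoly_ring_prod_closed:
  "(\<And>a. a \<in> A \<Longrightarrow> f a \<in> carrier (mpoly_ring V)) \<Longrightarrow> prod f A \<in> carrier (mpoly_ring V)"
  by (induction A rule: infinite_finite_induct)
    (auto simp: mpoly_ring_mult_closed carrier_mpoly_ring[of 1])

lemma mpoly_ring_sum_closed:
  "(\<And>a. a \<in> A \<Longrightarrow> f a \<in> carrier (mpoly_ring V)) \<Longrightarrow> sum f A \<in> carrier (mpoly_ring V)"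
  by (induction A rule: infinite_finite_induct)
    (auto simp: mpoly_ring_add_closed carrier_mpoly_ring[of 0])

lemma mpoly_ring_power_closed:
  "p \<in> carrier (mpoly_ring V) \<Longrightarrow> p ^ n \<in> carrier (mpoly_ring V)"
  by (induction n) (auto simp: mpoly_ring_mult_closed carrier_mpoly_ring[of 1])

lemma sum_keys_add:
  fixes m n :: "'a \<Rightarrow>\<^sub>0 nat"
  shows "(\<Sum>i\<in>Poly_Mapping.keys (m + n). Poly_Mapping.lookup (m + n) i) =
    (\<Sum>i\<in>Poly_Mapping.keys m. Poly_Mapping.lookup m i) +
    (\<Sum>i\<in>Poly_Mapping.keys n. Poly_Mapping.lookup n i)"
  by (rule setsum_keys_plus_distrib[where f = "\<lambda>_ x. x"]) auto

lemma homogeneous_mult: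
  assumes "homogeneous a p" "homogeneous b q" shows "homogeneous (a + b) (p * q)"
  unfolding homogeneous_def
proof
  fix k assume "k \<in> Poly_Mapping.keys (p * q)"
  then obtain m n where k: "k = m + n" "m \<in> Poly_Mapping.keys p" "n \<in> Poly_Mapping.keys q"
    using keys_mult[of p q] by blast
  then show "(\<Sum>i\<in>Poly_Mapping.keys k. Poly_Mapping.lookup k i) = a + b"
    using assms by (simp add: sum_keys_add homogeneous_def)
qed

lemma homogeneous_one: "homogeneous 0 1"
  by (simp add: homogeneous_def)

lemma homogeneous_power: "homogeneous a p \<Longrightarrow> homogeneous (n * a) (p ^ n)"
  by (induction n) (auto simp: homogeneous_one intro: homogeneous_mult)

lemma homogeneous_prod:
  "finite A \<Longrightarrow> (\<And>x. x \<in> A \<Longrightarrow> homogeneous (d x) (f x)) \<Longrightarrow> homogeneous (sum d A) (prod f A)"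
  by (induction A rule: finite_induct) (auto simp: homogeneous_one intro: homogeneous_mult)

lemma homogeneous_add:
  assumes "homogeneous d p" "homogeneous d q" shows "homogeneous d (p + q)"
  using assms keys_add[of p q] unfolding homogeneous_def by blast

lemma homogeneous_sum:
  "(\<And>x. x \<in> A \<Longrightarrow> homogeneous d (f x)) \<Longrightarrow> homogeneous d (sum f A)"
  by (induction A rule: infinite_finite_induct)
    (auto simp: homogeneous_def[of _ 0] intro: homogeneous_add)

lemma homogeneous_mvar: "homogeneous 1 (mvar i)"
  by (simp add: homogeneous_def mvar_def)

lemma homogeneous_mconst: "homogeneous 0 (mconst c)"
  by (simp add: homogeneous_def mconst_def)

lemma poly_eval_one: "poly_eval 1 v = 1"
  by (simp add: poly_eval_def)

lemma poly_eval_prod: "poly_eval (prod f A) v = (\<Prod>a\<in>A. poly_eval (f a) v)"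
  by (induction A rule: infinite_finite_induct) (simp_all add: poly_eval_mult poly_eval_one)

lemma poly_eval_power: "poly_eval (p ^ n) v = poly_eval p v ^ n"
  by (induction n) (simp_all add: poly_eval_mult poly_eval_one)

lemma poly_eval_mvar: "poly_eval (mvar i) v = Poly_Mapping.lookup v i"
  by (simp add: mvar_def poly_eval_single mono_eval_def)

lemma poly_eval_mconst: "poly_eval (mconst c) v = c"
  by (simp add: mconst_def poly_eval_single mono_eval_def)

lemma lookup_induced_map:
  assumes "finite V" "Poly_Mapping.keys v \<subseteq> V"
  shows "Poly_Mapping.lookup (induced_map \<phi> v) c = (\<Sum>i | i \<in> V \<and> \<phi> i = c. Poly_Mapping.lookup v i)"
proof -
  have "Poly_Mapping.lookup (induced_map \<phi> v) c =
      (\<Sum>i\<in>Poly_Mapping.keys v. if \<phi> i = c then Poly_Mapping.lookup v i else 0)"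
    unfolding induced_map_def lookup_sum
    by (rule sum.cong) (auto simp: lookup_scaleR_real lookup_single when_def)
  also have "\<dots> = (\<Sum>i\<in>V. if \<phi> i = c then Poly_Mapping.lookup v i else 0)"
    by (rule sum.mono_neutral_left) (use assms in \<open>auto simp: in_keys_iff\<close>)
  finally show ?thesis using assms(1) by (simp add: sum.inter_filter)
qed

lemma induced_map_coord_variety:
  assumes sc: "abstract_simplicial_complex V \<Delta>" "abstract_simplicial_complex W \<Gamma>"
    and "simplicial_map V \<Delta> W \<Gamma> \<phi>" and v: "v \<in> coord_variety \<Delta>"
  shows "induced_map \<phi> v \<in> coord_variety \<Gamma>"
proof -
  have k: "Poly_Mapping.keys v \<in> \<Delta>" using v coord_variety_iff[OF sc(1)] by simp
  then have "Poly_Mapping.keys v \<subseteq> V" "finite V"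
    using sc(1) unfolding abstract_simplicial_complex_def by auto
  then have "c \<in> \<phi> ` Poly_Mapping.keys v" if "c \<in> Poly_Mapping.keys (induced_map \<phi> v)" for c
  proof -
    have "(\<Sum>i | i \<in> V \<and> \<phi> i = c. Poly_Mapping.lookup v i) \<noteq> 0"
      using that lookup_induced_map[OF \<open>finite V\<close> \<open>Poly_Mapping.keys v \<subseteq> V\<close>, of \<phi> c]
      by (simp add: in_keys_iff)
    then obtain i where "\<phi> i = c" "Poly_Mapping.lookup v i \<noteq> 0"
      by (auto elim: sum.not_neutral_contains_not_neutral)
    then show ?thesis by (auto simp: in_keys_iff)
  qed
  then have "Poly_Mapping.keys (induced_map \<phi> v) \<subseteq> \<phi> ` Poly_Mapping.keys v" by blast
  moreover have "\<phi> ` Poly_Mapping.keys v \<in> \<Gamma>"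
    using assms(3) k by (simp add: simplicial_map_def)
  ultimately show ?thesis
    using sc(2) unfolding coord_variety_iff[OF sc(2)] abstract_simplicial_complex_def by blast
qed

lemma pullback_ex1:
  assumes sc: "abstract_simplicial_complex V \<Delta>" "abstract_simplicial_complex W \<Gamma>"
    and map: "simplicial_map V \<Delta> W \<Gamma> \<phi>" and f: "f \<in> R2 W \<Gamma>"
  shows "\<exists>!g. g \<in> R2 V \<Delta> \<and>
    (\<forall>v\<in>coord_variety \<Delta>. SR_eval g v = SR_eval f (induced_map \<phi> v))"
proof -
  have finV: "finite V" using sc(1) by (simp add: abstract_simplicial_complex_def)
  obtain p where p: "p \<in> carrier (mpoly_ring W)" "homogeneous 2 p" "f = SR_class W \<Gamma> p"
    using f by (auto simp: R2_def)
  define q where "q = (\<Sum>m\<in>Poly_Mapping.keys p. mconst (Poly_Mapping.lookup p m) *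
    (\<Prod>c\<in>Poly_Mapping.keys m. (\<Sum>i | i \<in> V \<and> \<phi> i = c. mvar i) ^ Poly_Mapping.lookup m c))"
  have "q \<in> carrier (mpoly_ring V)"
    unfolding q_def
    by (intro mpoly_ring_sum_closed mpoly_ring_mult_closed mpoly_ring_prod_closed mpoly_ring_power_closed)
      (auto simp: carrier_mpoly_ring mconst_def mvar_def)
  moreover have "homogeneous 2 q"
    unfolding q_def
  proof (rule homogeneous_sum)
    fix m assume m: "m \<in> Poly_Mapping.keys p"
    have "homogeneous (0 + (\<Sum>c\<in>Poly_Mapping.keys m. Poly_Mapping.lookup m c * 1))
      (mconst (Poly_Mapping.lookup p m) *
        (\<Prod>c\<in>Poly_Mapping.keys m. (\<Sum>i | i \<in> V \<and> \<phi> i = c. mvar i) ^ Poly_Mapping.lookup m c))"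
      by (intro homogeneous_mult homogeneous_mconst homogeneous_prod homogeneous_power
          homogeneous_sum homogeneous_mvar) simp
    then show "homogeneous 2 (mconst (Poly_Mapping.lookup p m) *
        (\<Prod>c\<in>Poly_Mapping.keys m. (\<Sum>i | i \<in> V \<and> \<phi> i = c. mvar i) ^ Poly_Mapping.lookup m c))"
      using m p(2) by (simp add: homogeneous_def)
  qed
  ultimately have q: "SR_class V \<Delta> q \<in> R2 V \<Delta>" by (auto simp: R2_def)
  have ev: "SR_eval (SR_class V \<Delta> q) v = SR_eval f (induced_map \<phi> v)" if v: "v \<in> coord_variety \<Delta>" for v
  proof -
    have "Poly_Mapping.keys v \<in> \<Delta>" using v coord_variety_iff[OF sc(1)] by simp
    then have "Poly_Mapping.keys v \<subseteq> V" using sc(1) by (auto simp: abstract_simplicial_complex_def)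
    then have "poly_eval q v = poly_eval p (induced_map \<phi> v)"
      unfolding q_def poly_eval_def[of p]
      by (simp add: poly_eval_sum poly_eval_mult poly_eval_mconst poly_eval_prod poly_eval_power
          poly_eval_mvar lookup_induced_map[OF finV])
    then show ?thesis
      using SR_eval_class[OF sc(1) v] SR_eval_class[OF sc(2) induced_map_coord_variety[OF sc map v]]
      by (simp add: p(3))
  qed
  have uniq: "g = SR_class V \<Delta> q"
    if g: "g \<in> R2 V \<Delta>" "\<forall>v\<in>coord_variety \<Delta>. SR_eval g v = SR_eval f (induced_map \<phi> v)" for g
  proof -
    obtain r where r: "r \<in> carrier (mpoly_ring V)" "homogeneous 2 r" "g = SR_class V \<Delta> r"
      using g(1) by (auto simp: R2_def)
    have "r - q \<in> nonface_polys V \<Delta>"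
    proof (rule homogeneous2_vanishing[OF sc(1)])
      show "r - q \<in> carrier (mpoly_ring V)"
        using mpoly_ring_add_closed[OF r(1) mpoly_ring_uminus_closed[OF \<open>q \<in> carrier _\<close>]] by simp
      have "homogeneous 2 (- q)" using \<open>homogeneous 2 q\<close> by (simp add: homogeneous_def)
      then show "homogeneous 2 (r - q)" using homogeneous_add[OF r(2)] by fastforce
      show "poly_eval (r - q) v = 0" if "v \<in> coord_variety \<Delta>" for v
        proof -
        have "SR_eval g v = SR_eval f (induced_map \<phi> v)" using g(2) that by blast
        then show ?thesis
          using ev[OF that] SR_eval_class[OF sc(1) that] by (simp add: poly_eval_diff r(3))
      qed
    qed
    then show ?thesis using SR_class_eqI[OF sc(1)] r(3) by simp
  qed
  show ?thesis using q ev uniq by blast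
qed

end

theory Submission
  imports Defs
begin

text \<open>
  An element of \<open>R2 V \<Delta>\<close> is a symmetric matrix whose entries matter only at pairs lying in a common
  face. Suppose \<open>a + b\<close> is a pullback with \<open>a\<close>, \<open>b\<close> nonnegative. If \<open>i\<close>, \<open>i'\<close> lie in a face and have the
  same image, then \<open>e\<^sub>i - e\<^bsub>i'\<^esub>\<close> is mapped to \<open>0\<close>, so \<open>a\<close> and \<open>b\<close> both vanish at it; being positive
  semidefinite on faces, \<open>a\<close> has \<open>e\<^sub>i - e\<^bsub>i'\<^esub>\<close> in its kernel on every face containing \<open>i\<close> and \<open>i'\<close>. Thus the
  \<open>(i, j)\<close> entry of \<open>a\<close> is unchanged along the chains provided by strong connectivity, so it depends
  only on \<open>(\<phi> i, \<phi> j)\<close>, and \<open>a\<close> descends to a form on \<open>\<Gamma>\<close>. That form is nonnegative because every point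
  of the variety of \<open>\<Gamma>\<close> lifts to the variety of \<open>\<Delta>\<close>.
\<close>

subsection \<open>Operations on degree 2 classes\<close>

lemma R2_E:
  assumes "f \<in> R2 V \<Delta>"
  obtains p where "p \<in> carrier (mpoly_ring V)" "homogeneous 2 p" "f = SR_class V \<Delta> p"
  using assms by (auto simp: R2_def)

lemma R2_I:
  "p \<in> carrier (mpoly_ring V) \<Longrightarrow> homogeneous 2 p \<Longrightarrow> SR_class V \<Delta> p \<in> R2 V \<Delta>"
  by (auto simp: R2_def)

lemma ideal_SR_ideal:
  assumes "abstract_simplicial_complex V \<Delta>"
  shows "ideal (SR_ideal V \<Delta>) (mpoly_ring V)"
  using ideal_nonface_polys[OF assms] SR_ideal_eq[OF assms] by simp

lemma SR_class_add:
  assumes "abstract_simplicial_complex V \<Delta>"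
    and "p \<in> carrier (mpoly_ring V)" "q \<in> carrier (mpoly_ring V)"
  shows "SR_class V \<Delta> p \<oplus>\<^bsub>SR_ring V \<Delta>\<^esub> SR_class V \<Delta> q = SR_class V \<Delta> (p + q)"
proof -
  interpret I: ideal "SR_ideal V \<Delta>" "mpoly_ring V" by (rule ideal_SR_ideal[OF assms(1)])
  show ?thesis
    using I.a_rcos_sum[OF assms(2,3)]
    by (simp add: SR_class_def SR_ring_def FactRing_def mpoly_ring_def)
qed

lemma SR_class_mult:
  assumes "abstract_simplicial_complex V \<Delta>"
    and "p \<in> carrier (mpoly_ring V)" "q \<in> carrier (mpoly_ring V)"
  shows "SR_class V \<Delta> p \<otimes>\<^bsub>SR_ring V \<Delta>\<^esub> SR_class V \<Delta> q = SR_class V \<Delta> (p * q)"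
proof -
  interpret I: ideal "SR_ideal V \<Delta>" "mpoly_ring V" by (rule ideal_SR_ideal[OF assms(1)])
  show ?thesis
    using I.rcoset_mult_add[OF assms(2,3)]
    by (simp add: SR_class_def SR_ring_def FactRing_def mpoly_ring_def)
qed

lemma mconst_closed: "mconst c \<in> carrier (mpoly_ring V)"
  by (auto simp: carrier_mpoly_ring mconst_def)

lemma mvar_closed: "i \<in> V \<Longrightarrow> mvar i \<in> carrier (mpoly_ring V)"
  by (auto simp: carrier_mpoly_ring mvar_def)

text \<open>Both parts pass to homogeneous representatives, where the quotient sum is an ordinary
  sum of polynomials and evaluation is additive.\<close>

lemma R2_add:
  assumes sc: "abstract_simplicial_complex V \<Delta>" and fg: "f \<in> R2 V \<Delta>" "g \<in> R2 V \<Delta>"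
  shows R2_add_closed: "f \<oplus>\<^bsub>SR_ring V \<Delta>\<^esub> g \<in> R2 V \<Delta>"
    and SR_eval_add: "v \<in> coord_variety \<Delta> \<Longrightarrow>
      SR_eval (f \<oplus>\<^bsub>SR_ring V \<Delta>\<^esub> g) v = SR_eval f v + SR_eval g v"
proof -
  obtain p where p: "p \<in> carrier (mpoly_ring V)" "homogeneous 2 p" "f = SR_class V \<Delta> p"
    using fg(1) by (rule R2_E)
  obtain q where q: "q \<in> carrier (mpoly_ring V)" "homogeneous 2 q" "g = SR_class V \<Delta> q"
    using fg(2) by (rule R2_E)
  have eq: "f \<oplus>\<^bsub>SR_ring V \<Delta>\<^esub> g = SR_class V \<Delta> (p + q)"
    using SR_class_add[OF sc p(1) q(1)] p(3) q(3) by simp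
  show "f \<oplus>\<^bsub>SR_ring V \<Delta>\<^esub> g \<in> R2 V \<Delta>"
    unfolding eq by (intro R2_I mpoly_ring_add_closed homogeneous_add p q)
  show "SR_eval (f \<oplus>\<^bsub>SR_ring V \<Delta>\<^esub> g) v = SR_eval f v + SR_eval g v"
    if "v \<in> coord_variety \<Delta>"
    using SR_eval_class[OF sc that] unfolding eq unfolding p(3) q(3) by (simp add: poly_eval_add)
qed

lemma R2_scale:
  assumes sc: "abstract_simplicial_complex V \<Delta>" and f: "f \<in> R2 V \<Delta>"
  shows R2_scale_closed: "SR_scale V \<Delta> c f \<in> R2 V \<Delta>"
    and SR_eval_scale: "v \<in> coord_variety \<Delta> \<Longrightarrow> SR_eval (SR_scale V \<Delta> c f) v = c * SR_eval f v"
proof -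
  obtain p where p: "p \<in> carrier (mpoly_ring V)" "homogeneous 2 p" "f = SR_class V \<Delta> p"
    using f by (rule R2_E)
  have eq: "SR_scale V \<Delta> c f = SR_class V \<Delta> (mconst c * p)"
    using SR_class_mult[OF sc mconst_closed p(1)] p(3) by (simp add: SR_scale_def)
  have "homogeneous 2 (mconst c * p)"
    using homogeneous_mult[OF homogeneous_mconst p(2)] by (metis add_0)
  then show "SR_scale V \<Delta> c f \<in> R2 V \<Delta>"
    unfolding eq by (intro R2_I mpoly_ring_mult_closed mconst_closed p)
  show "SR_eval (SR_scale V \<Delta> c f) v = c * SR_eval f v" if "v \<in> coord_variety \<Delta>"
    using SR_eval_class[OF sc that] unfolding eq unfolding p(3) by (simp add: poly_eval_mult poly_eval_mconst)
qed

lemma R2_zero: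
  assumes "abstract_simplicial_complex V \<Delta>"
  shows R2_zero_closed: "SR_class V \<Delta> 0 \<in> R2 V \<Delta>"
    and SR_eval_zero: "v \<in> coord_variety \<Delta> \<Longrightarrow> SR_eval (SR_class V \<Delta> 0) v = 0"
  using assms by (auto intro: R2_I simp: carrier_mpoly_ring homogeneous_def SR_eval_class poly_eval_0)

lemma zero_in_P_cone:
  "abstract_simplicial_complex V \<Delta> \<Longrightarrow> SR_class V \<Delta> 0 \<in> P_cone V \<Delta>"
  by (simp add: P_cone_def R2_zero)

lemma P_cone_convex_cone:
  assumes "abstract_simplicial_complex V \<Delta>"
  shows "R2_convex_cone V \<Delta> (P_cone V \<Delta>)"
  using zero_in_P_cone[OF assms] unfolding R2_convex_cone_def
  by (auto simp: P_cone_def R2_add_closed[OF assms] SR_eval_add[OF assms]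
      R2_scale_closed[OF assms] SR_eval_scale[OF assms])

subsection \<open>Pullbacks\<close>

context
  fixes V :: "'a set" and \<Delta> :: "'a set set" and W :: "'b set" and \<Gamma> :: "'b set set"
    and \<phi> :: "'a \<Rightarrow> 'b"
  assumes sc: "abstract_simplicial_complex V \<Delta>" "abstract_simplicial_complex W \<Gamma>"
    and map: "simplicial_map V \<Delta> W \<Gamma> \<phi>"
begin

lemma pullback_R2:
  assumes "f \<in> R2 W \<Gamma>"
  shows pullback_closed: "pullback V \<Delta> \<phi> f \<in> R2 V \<Delta>"
    and SR_eval_pullback: "v \<in> coord_variety \<Delta> \<Longrightarrow>
      SR_eval (pullback V \<Delta> \<phi> f) v = SR_eval f (induced_map \<phi> v)"
  using theI'[OF pullback_ex1[OF sc map assms]] unfolding pullback_def by blast+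

text \<open>The uniqueness half of \<open>pullback_ex1\<close>: identities between classes on
  \<open>\<Delta>\<close> become identities between functions on the variety.\<close>

lemma pullback_eqI:
  assumes "f \<in> R2 W \<Gamma>" "g \<in> R2 V \<Delta>"
    and "\<And>v. v \<in> coord_variety \<Delta> \<Longrightarrow> SR_eval g v = SR_eval f (induced_map \<phi> v)"
  shows "pullback V \<Delta> \<phi> f = g"
  unfolding pullback_def by (rule the1_equality[OF pullback_ex1[OF sc map]]) (use assms in auto)

lemma pullback_P_cone:
  assumes "f \<in> P_cone W \<Gamma>"
  shows "pullback V \<Delta> \<phi> f \<in> P_cone V \<Delta>"
  using assms induced_map_coord_variety[OF sc map]
  by (auto simp: P_cone_def pullback_R2)

text \<open>Evaluation shows that the pullback commutes with sums and scaling, so the cone axioms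
  transfer from \<open>P_cone W \<Gamma>\<close> to its image.\<close>

lemma pullback_image_convex_cone:
  "R2_convex_cone V \<Delta> (pullback V \<Delta> \<phi> ` P_cone W \<Gamma>)"
proof -
  note iv = induced_map_coord_variety[OF sc map]
  have add: "pullback V \<Delta> \<phi> (f \<oplus>\<^bsub>SR_ring W \<Gamma>\<^esub> g) =
      pullback V \<Delta> \<phi> f \<oplus>\<^bsub>SR_ring V \<Delta>\<^esub> pullback V \<Delta> \<phi> g"
    if "f \<in> R2 W \<Gamma>" "g \<in> R2 W \<Gamma>" for f g
    by (rule pullback_eqI) (use that iv in
        \<open>simp_all add: pullback_R2 R2_add_closed[OF sc(1)] R2_add_closed[OF sc(2)]
          SR_eval_add[OF sc(1)] SR_eval_add[OF sc(2)]\<close>)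
  have scale: "pullback V \<Delta> \<phi> (SR_scale W \<Gamma> c f) = SR_scale V \<Delta> c (pullback V \<Delta> \<phi> f)"
    if "f \<in> R2 W \<Gamma>" for c f
    by (rule pullback_eqI) (use that iv in
        \<open>simp_all add: pullback_R2 R2_scale_closed[OF sc(1)] R2_scale_closed[OF sc(2)]
          SR_eval_scale[OF sc(1)] SR_eval_scale[OF sc(2)]\<close>)
  have PR: "f \<in> R2 W \<Gamma>" if "f \<in> P_cone W \<Gamma>" for f
    using that by (simp add: P_cone_def)
  show ?thesis
    using P_cone_convex_cone[OF sc(2)] unfolding R2_convex_cone_def
    by (auto simp: add[OF PR PR, symmetric] scale[OF PR, symmetric] pullback_closed PR)
qed

end

subsection \<open>Degree 2 classes as symmetric matrices\<close>

lemma exponent_split: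
  fixes m :: "'a \<Rightarrow>\<^sub>0 nat"
  assumes "m \<noteq> 0"
  obtains i n where "m = Poly_Mapping.single i 1 + n"
proof -
  obtain i where i: "Poly_Mapping.lookup m i \<noteq> 0"
    using assms by (metis poly_mapping_eqI lookup_zero)
  \<comment> \<open>Subtraction of exponents is truncated at zero; it is exact here because the
    exponent of \<open>i\<close> in \<open>m\<close> is positive.\<close>
  have "m = Poly_Mapping.single i 1 + (m - Poly_Mapping.single i 1)"
    by (rule poly_mapping_eqI) (use i in \<open>auto simp: lookup_add lookup_minus lookup_single when_def\<close>)
  then show thesis by (rule that)
qed

text \<open>Splitting off a variable twice leaves an exponent of degree 0. The case
  \<open>i = j\<close> is a square.\<close>

lemma degree2_exponent:
  fixes m :: "'a \<Rightarrow>\<^sub>0 nat"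
  assumes "(\<Sum>i\<in>Poly_Mapping.keys m. Poly_Mapping.lookup m i) = 2"
  obtains i j where "m = Poly_Mapping.single i 1 + Poly_Mapping.single j 1"
proof -
  have "m \<noteq> 0" using assms by auto
  then obtain i n where m: "m = Poly_Mapping.single i 1 + n" by (rule exponent_split)
  have n: "(\<Sum>i\<in>Poly_Mapping.keys n. Poly_Mapping.lookup n i) = 1"
    using assms unfolding m sum_keys_add by simp
  then have "n \<noteq> 0" by auto
  then obtain j k where k: "n = Poly_Mapping.single j 1 + k" by (rule exponent_split)
  have "(\<Sum>i\<in>Poly_Mapping.keys k. Poly_Mapping.lookup k i) = 0"
    using n unfolding k sum_keys_add by simp
  then have "k = 0" by (intro poly_mapping_eqI) (auto simp: in_keys_iff)
  with m k that show thesis by simp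
qed

text \<open>Each monomial of \<open>p\<close> has a symmetric matrix \<open>K\<close>; the matrix of
  \<open>p\<close> is the combination of these with the coefficients of \<open>p\<close>.\<close>

lemma poly_eval_matrix:
  assumes V: "finite V" and p: "p \<in> carrier (mpoly_ring V)" "homogeneous 2 p"
  obtains M where "\<And>i j. M i j = M j i"
    and "\<And>v. poly_eval p v =
      (\<Sum>i\<in>V. \<Sum>j\<in>V. M i j * Poly_Mapping.lookup v i * Poly_Mapping.lookup v j)"
proof -
  have "\<exists>K. (\<forall>i j. K i j = K j i) \<and> (\<forall>v. mono_eval m v =
      (\<Sum>i\<in>V. \<Sum>j\<in>V. K i j * Poly_Mapping.lookup v i * Poly_Mapping.lookup v j))"
    if m: "m \<in> Poly_Mapping.keys p" for m
  proof -
    have "(\<Sum>i\<in>Poly_Mapping.keys m. Poly_Mapping.lookup m i) = 2"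
      using p(2) m by (simp add: homogeneous_def)
    then obtain a b where ab: "m = Poly_Mapping.single a 1 + Poly_Mapping.single b 1"
      by (rule degree2_exponent)
    have "Poly_Mapping.keys m \<subseteq> V" using p(1) m by (simp add: carrier_mpoly_ring)
    then have abV: "a \<in> V" "b \<in> V" by (auto simp: ab keys_add_nat)
    \<comment> \<open>The monomial in \<open>a\<close> and \<open>b\<close> puts one half at
      \<open>(a, b)\<close> and one half at \<open>(b, a)\<close>; for \<open>a = b\<close> the two
      halves add up to 1 on the diagonal.\<close>
    define K :: "'a \<Rightarrow> 'a \<Rightarrow> real" where
      "K i j = ((if i = a then 1 else 0) * (if j = b then 1 else 0)
              + (if i = b then 1 else 0) * (if j = a then 1 else 0)) / 2" for i j
    \<comment> \<open>Nested conditionals let both sums over \<open>V\<close> collapse to single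
      terms.\<close>
    have "K i j * x * y = (if i = a then (if j = b then x * y / 2 else 0) else 0)
        + (if i = b then (if j = a then x * y / 2 else 0) else 0)" for i j and x y :: real
      by (simp add: K_def)
    then have "(\<Sum>i\<in>V. \<Sum>j\<in>V. K i j * Poly_Mapping.lookup v i * Poly_Mapping.lookup v j) =
        Poly_Mapping.lookup v a * Poly_Mapping.lookup v b" for v :: "'a \<Rightarrow>\<^sub>0 real"
      using abV V
      by (simp add: sum.distrib if_distrib[where f = "\<lambda>f. sum f _"] sum.If_cases sum.delta cong: if_cong)
    moreover have "mono_eval m v = Poly_Mapping.lookup v a * Poly_Mapping.lookup v b"
      for v :: "'a \<Rightarrow>\<^sub>0 real"
      unfolding ab mono_eval_add by (simp add: mono_eval_def)
    moreover have "K i j = K j i" for i j by (simp add: K_def)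
    ultimately show ?thesis by (intro exI[of _ K]) simp
  qed
  then obtain K where K': "\<forall>m\<in>Poly_Mapping.keys p. (\<forall>i j. K m i j = K m j i) \<and> (\<forall>v. mono_eval m v =
      (\<Sum>i\<in>V. \<Sum>j\<in>V. K m i j * Poly_Mapping.lookup v i * Poly_Mapping.lookup v j))"
    using bchoice[of "Poly_Mapping.keys p" "\<lambda>m K. (\<forall>i j. K i j = K j i) \<and> (\<forall>v. mono_eval m v =
      (\<Sum>i\<in>V. \<Sum>j\<in>V. K i j * Poly_Mapping.lookup v i * Poly_Mapping.lookup v j))"] by auto
  then have Ksym: "\<And>m i j. m \<in> Poly_Mapping.keys p \<Longrightarrow> K m i j = K m j i"
    and K: "\<And>m v. m \<in> Poly_Mapping.keys p \<Longrightarrow> mono_eval m v =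
      (\<Sum>i\<in>V. \<Sum>j\<in>V. K m i j * Poly_Mapping.lookup v i * Poly_Mapping.lookup v j)"
    by simp_all
  show thesis
  proof (rule that[of "\<lambda>i j. \<Sum>m\<in>Poly_Mapping.keys p. Poly_Mapping.lookup p m * K m i j"])
    show "(\<Sum>m\<in>Poly_Mapping.keys p. Poly_Mapping.lookup p m * K m i j) =
      (\<Sum>m\<in>Poly_Mapping.keys p. Poly_Mapping.lookup p m * K m j i)" for i j
      by (rule sum.cong) (simp_all add: Ksym[of _ i j])
    fix v :: "'a \<Rightarrow>\<^sub>0 real"
    have "poly_eval p v = (\<Sum>m\<in>Poly_Mapping.keys p. \<Sum>i\<in>V. \<Sum>j\<in>V.
        Poly_Mapping.lookup p m * K m i j * Poly_Mapping.lookup v i * Poly_Mapping.lookup v j)"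
      unfolding poly_eval_alt by (rule sum.cong) (simp_all add: K sum_distrib_left mult.assoc)
    also have "\<dots> = (\<Sum>i\<in>V. \<Sum>j\<in>V. \<Sum>m\<in>Poly_Mapping.keys p.
        Poly_Mapping.lookup p m * K m i j * Poly_Mapping.lookup v i * Poly_Mapping.lookup v j)"
      by (subst sum.swap) (intro sum.cong refl sum.swap)
    finally show "poly_eval p v = (\<Sum>i\<in>V. \<Sum>j\<in>V.
        (\<Sum>m\<in>Poly_Mapping.keys p. Poly_Mapping.lookup p m * K m i j) *
        Poly_Mapping.lookup v i * Poly_Mapping.lookup v j)"
      by (simp add: sum_distrib_right)
  qed
qed

lemma SR_eval_matrix:
  assumes sc: "abstract_simplicial_complex V \<Delta>" and f: "f \<in> R2 V \<Delta>"
  obtains M where "\<And>i j. M i j = M j i"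
    and "\<And>v. v \<in> coord_variety \<Delta> \<Longrightarrow> SR_eval f v =
      (\<Sum>i\<in>V. \<Sum>j\<in>V. M i j * Poly_Mapping.lookup v i * Poly_Mapping.lookup v j)"
proof -
  obtain p where p: "p \<in> carrier (mpoly_ring V)" "homogeneous 2 p" "f = SR_class V \<Delta> p"
    using f by (rule R2_E)
  have "finite V" using sc by (simp add: abstract_simplicial_complex_def)
  then show thesis
  proof (rule poly_eval_matrix[OF _ p(1,2)])
    fix M
    assume M: "\<And>i j. M i j = M j i" "\<And>v. poly_eval p v =
      (\<Sum>i\<in>V. \<Sum>j\<in>V. M i j * Poly_Mapping.lookup v i * Poly_Mapping.lookup v j)"
    show thesis
      by (rule that[of M, OF M(1)]) (simp add: p(3) SR_eval_class[OF sc] M(2)[symmetric])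
  qed
qed

text \<open>The converse of \<open>SR_eval_matrix\<close>, used to build the descended form on
  \<open>\<Gamma>\<close> from its entries.\<close>

lemma matrix_R2:
  assumes sc: "abstract_simplicial_complex V \<Delta>"
  obtains f where "f \<in> R2 V \<Delta>"
    and "\<And>v. v \<in> coord_variety \<Delta> \<Longrightarrow> SR_eval f v =
      (\<Sum>i\<in>V. \<Sum>j\<in>V. M i j * Poly_Mapping.lookup v i * Poly_Mapping.lookup v j)"
proof -
  define p where "p = (\<Sum>i\<in>V. \<Sum>j\<in>V. mconst (M i j) * (mvar i * mvar j))"
  have "homogeneous (0 + (1 + 1)) (mconst (M i j) * (mvar i * mvar j))" for i j
    by (intro homogeneous_mult homogeneous_mconst homogeneous_mvar)
  then have "homogeneous 2 p"
    unfolding p_def by (intro homogeneous_sum) (simp add: numeral_2_eq_2)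
  moreover have "p \<in> carrier (mpoly_ring V)"
    unfolding p_def
    by (intro mpoly_ring_sum_closed mpoly_ring_mult_closed mconst_closed mvar_closed)
  ultimately have "SR_class V \<Delta> p \<in> R2 V \<Delta>" by (intro R2_I)
  then show thesis
    by (rule that) (simp add: SR_eval_class[OF sc] p_def poly_eval_sum poly_eval_mult
        poly_eval_mconst poly_eval_mvar mult.assoc)
qed

subsection \<open>Descent of a summand of a pullback\<close>

text \<open>Transports a property along a chain of vertices or edges. The step may assume that both
  neighbours belong to the list, which is how the fibre condition on chain members becomes
  available.\<close>

lemma successively_invariant:
  assumes "successively R xs" "xs \<noteq> []" "P (hd xs)"
    and "\<And>x y. x \<in> set xs \<Longrightarrow> y \<in> set xs \<Longrightarrow> R x y \<Longrightarrow> P x \<Longrightarrow> P y"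
  shows "P (last xs)"
  using assms
proof (induction xs)
  case (Cons x xs)
  show ?case
  proof (cases xs)
    case Nil
    then show ?thesis using Cons.prems by simp
  next
    case (Cons y ys)
    have "P y" using Cons.prems Cons by auto
    moreover have "P y'" if "x' \<in> set xs" "y' \<in> set xs" "R x' y'" "P x'" for x' y'
      using Cons.prems(4)[of x' y'] that by simp
    ultimately have "P (last xs)"
      by (intro Cons.IH) (use Cons.prems(1) Cons in simp_all)
    then show ?thesis using Cons by simp
  qed
qed simp

lemma linear_nonneg_imp_zero:
  fixes a b :: real
  assumes "\<And>t. a + t * b \<ge> 0"
  shows "b = 0"
proof (rule ccontr)
  assume "b \<noteq> 0"
  \<comment> \<open>At this \<open>t\<close> the affine function takes the value -1.\<close>
  then show False using assms[of "- (a + 1) / b"] by simp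
qed

lemma zero_coord_variety:
  assumes "abstract_simplicial_complex V \<Delta>" "F \<in> \<Delta>"
  shows "0 \<in> coord_variety \<Delta>"
  using assms unfolding coord_variety_iff[OF assms(1)] abstract_simplicial_complex_def by auto

text \<open>The vector \<open>e\<^sub>i\<close> minus the basis vector at \<open>i'\<close> lies in
  the kernel of the induced map, so \<open>a\<close> vanishes there. Adding \<open>t\<close> times
  this vector to \<open>e\<^sub>j\<close> stays inside the face, and the value of \<open>a\<close>
  is then affine in \<open>t\<close> with slope \<open>2 * (M i j - M i' j)\<close>. Nonnegativity
  for all \<open>t\<close> forces the slope to be 0.\<close>

lemma summand_entries_eq:
  assumes sc: "abstract_simplicial_complex V \<Delta>" "abstract_simplicial_complex W \<Gamma>"
    and map: "simplicial_map V \<Delta> W \<Gamma> \<phi>"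
    and a: "a \<in> P_cone V \<Delta>" and b: "b \<in> P_cone V \<Delta>" and f: "f \<in> R2 W \<Gamma>"
    and ab: "a \<oplus>\<^bsub>SR_ring V \<Delta>\<^esub> b = pullback V \<Delta> \<phi> f"
    and sym: "\<And>i j. M i j = M j i"
    and M: "\<And>v. v \<in> coord_variety \<Delta> \<Longrightarrow> SR_eval a v =
      (\<Sum>i\<in>V. \<Sum>j\<in>V. M i j * Poly_Mapping.lookup v i * Poly_Mapping.lookup v j)"
    and face: "{i, i', j} \<in> \<Delta>" and eq: "\<phi> i = \<phi> i'"
  shows "M i j = M i' j"
proof -
  have V: "finite V" "i \<in> V" "i' \<in> V" "j \<in> V"
    using sc(1) face by (auto simp: abstract_simplicial_complex_def)
  have aR: "a \<in> R2 V \<Delta>" "b \<in> R2 V \<Delta>"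
    and nonneg: "v \<in> coord_variety \<Delta> \<Longrightarrow> 0 \<le> SR_eval a v"
      "v \<in> coord_variety \<Delta> \<Longrightarrow> 0 \<le> SR_eval b v" for v
    using a b by (auto simp: P_cone_def)
  define u :: "real \<Rightarrow> real \<Rightarrow> 'a \<Rightarrow>\<^sub>0 real" where
    "u s t = Poly_Mapping.single j s + Poly_Mapping.single i t - Poly_Mapping.single i' t" for s t
  \<comment> \<open>A sum of three conditionals remains valid when some of \<open>i\<close>,
    \<open>i'\<close>, \<open>j\<close> coincide, as happens in later applications.\<close>
  have lu: "Poly_Mapping.lookup (u s t) k =
      (if k = j then s else 0) + (if k = i then t else 0) - (if k = i' then t else 0)" for s t k
    by (auto simp: u_def lookup_add lookup_minus lookup_single when_def)
  have ku: "Poly_Mapping.keys (u s t) \<subseteq> {i, i', j}" for s t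
    by (auto simp: in_keys_iff lu split: if_splits)
  then have uc: "u s t \<in> coord_variety \<Delta>" for s t
    using face sc(1) unfolding coord_variety_iff[OF sc(1)] abstract_simplicial_complex_def by metis
  \<comment> \<open>Pairing any \<open>h\<close> with \<open>u s t\<close>; using it once for each
    index expands the quadratic form in \<open>ev\<close>.\<close>
  have lin: "(\<Sum>k\<in>V. h k * Poly_Mapping.lookup (u s t) k) = s * h j + t * (h i - h i')" for h s t
    using V by (simp add: lu distrib_left right_diff_distrib sum.distrib sum_subtractf
        if_distrib[where f = "\<lambda>x. _ * x"] sum.delta mult.commute cong: if_cong)
  have ev: "SR_eval a (u s t) = s\<^sup>2 * M j j + 2 * s * t * (M i j - M i' j)
      + t\<^sup>2 * (M i i - M i i' - M i' i + M i' i')" for s t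
  proof -
    have "SR_eval a (u s t) = (\<Sum>k\<in>V. (\<Sum>l\<in>V. M k l * Poly_Mapping.lookup (u s t) l) *
        Poly_Mapping.lookup (u s t) k)"
      unfolding M[OF uc] sum_distrib_right by (intro sum.cong refl) (simp add: mult_ac)
    also have "\<dots> = s * (s * M j j + t * (M j i - M j i'))
        + t * ((s * M i j + t * (M i i - M i i')) - (s * M i' j + t * (M i' i - M i' i')))"
      unfolding lin ..
    finally show ?thesis
      using sym[of j i] sym[of j i'] by (simp add: algebra_simps power2_eq_square)
  qed
  have ind0: "induced_map \<phi> (u 0 1) = 0"
  proof (rule poly_mapping_eqI)
    fix c
    have "Poly_Mapping.keys (u 0 1) \<subseteq> V"
      using ku[of 0 1] V(2-4) by blast
    then have "Poly_Mapping.lookup (induced_map \<phi> (u 0 1)) c =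
        (\<Sum>k | k \<in> V \<and> \<phi> k = c. Poly_Mapping.lookup (u 0 1) k)"
      by (rule lookup_induced_map[OF V(1)])
    \<comment> \<open>The fibre sum is a pairing with the indicator of the fibre over
      \<open>c\<close>, which takes equal values at \<open>i\<close> and \<open>i'\<close>.\<close>
    also have "\<dots> = (\<Sum>k\<in>V. (if \<phi> k = c then 1 else 0) * Poly_Mapping.lookup (u 0 1) k)"
      unfolding sum.inter_filter[OF V(1)] by (rule sum.cong) simp_all
    also have "\<dots> = 0"
      unfolding lin using eq by simp
    finally show "Poly_Mapping.lookup (induced_map \<phi> (u 0 1)) c = Poly_Mapping.lookup 0 c" by simp
  qed
  have "SR_eval a (u 0 1) + SR_eval b (u 0 1) = SR_eval f 0"
    using SR_eval_add[OF sc(1) aR uc[of 0 1]] SR_eval_pullback[OF sc map f uc[of 0 1]]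
    by (simp add: ab ind0)
  \<comment> \<open>Evaluation is controlled only on the variety, so a face of
    \<open>\<Gamma>\<close> is needed to place the origin in it.\<close>
  moreover have "SR_eval f 0 = 0"
  proof -
    have "\<phi> ` {i, i', j} \<in> \<Gamma>" using map face unfolding simplicial_map_def by blast
    then have z: "0 \<in> coord_variety \<Gamma>" by (rule zero_coord_variety[OF sc(2)])
    show ?thesis
    proof (rule SR_eval_matrix[OF sc(2) f])
      fix L
      assume "\<And>w. w \<in> coord_variety \<Gamma> \<Longrightarrow> SR_eval f w =
        (\<Sum>c\<in>W. \<Sum>d\<in>W. L c d * Poly_Mapping.lookup w c * Poly_Mapping.lookup w d)"
      from this[OF z] show "SR_eval f 0 = 0" by simp
    qed
  qed
  ultimately have "SR_eval a (u 0 1) = 0"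
    using nonneg[OF uc[of 0 1]] by linarith
  then have "M i i - M i i' - M i' i + M i' i' = 0" by (simp add: ev)
  then have "0 \<le> M j j + t * (2 * (M i j - M i' j))" for t
    using nonneg(1)[OF uc[of 1 t]] by (simp add: ev mult_ac)
  then have "2 * (M i j - M i' j) = 0" by (rule linear_nonneg_imp_zero)
  then show ?thesis by simp
qed

text \<open>If \<open>i\<close> and \<open>j\<close> have the same image, both entries equal
  diagonal ones, which a vertex chain in the fibre compares. Otherwise \<open>{i, j}\<close> and
  \<open>{i', j'}\<close> are edges over one edge of \<open>\<Gamma>\<close>, compared by an edge
  chain.\<close>

lemma strongly_connected_entries_eq:
  assumes sc: "abstract_simplicial_complex V \<Delta>"
    and conn: "strongly_connected V \<Delta> W \<Gamma> \<phi>"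
    and sym: "\<And>i j. M i j = M j i"
    and step: "\<And>i i' j. {i, i', j} \<in> \<Delta> \<Longrightarrow> \<phi> i = \<phi> i' \<Longrightarrow> M i j = M i' j"
    and ij: "{i, j} \<in> \<Delta>" "{i', j'} \<in> \<Delta>" and eq: "\<phi> i = \<phi> i'" "\<phi> j = \<phi> j'"
  shows "M i j = M i' j'"
proof -
  have V: "i \<in> V" "j \<in> V" "i' \<in> V" "j' \<in> V"
    using sc ij by (auto simp: abstract_simplicial_complex_def)
  have map: "simplicial_map V \<Delta> W \<Gamma> \<phi>"
    using conn by (simp add: strongly_connected_def surjective_simplicial_map_def)
  note conn' = conjunct2[OF conn[unfolded strongly_connected_def]]
  note vertex_chain = conjunct1[OF conn'] and edge_chain = conjunct2[OF conn']
  show ?thesis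
  proof (cases "\<phi> i = \<phi> j")
    case True
    have "\<phi> i \<in> W" using map V by (auto simp: simplicial_map_def)
    then obtain xs where xs: "xs \<noteq> []" "hd xs = i" "last xs = i'" "\<forall>x\<in>set xs. \<phi> x = \<phi> i"
      "successively (\<lambda>x y. {x, y} \<in> \<Delta>) xs"
      using vertex_chain[rule_format, OF V(1,3) _ conjI[OF refl eq(1)[symmetric]]] by blast
    have "M (last xs) (last xs) = M i i"
    proof (rule successively_invariant[where P = "\<lambda>x. M x x = M i i", OF xs(5,1)])
      show "M (hd xs) (hd xs) = M i i" by (simp add: xs)
      fix x y assume "x \<in> set xs" "y \<in> set xs" and xy: "{x, y} \<in> \<Delta>" and x: "M x x = M i i"
      then have "\<phi> x = \<phi> y" using xs(4) by simp
      then have "M x x = M y x" "M x y = M y y"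
        using xy step[of x y x] step[of x y y] by (simp_all add: insert_commute)
      with x sym[of x y] show "M y y = M i i" by simp
    qed
    \<comment> \<open>Inside a fibre an off-diagonal entry on an edge equals the diagonal entry, by
      \<open>step\<close> with a repeated index.\<close>
    moreover have "M j i = M i i" "M j' i' = M i' i'"
      using step[of j i i] step[of j' i' i'] ij eq True by (simp_all add: insert_commute)
    ultimately show ?thesis using xs(3) sym[of j i] sym[of j' i'] by simp
  next
    case False
    then have ne: "i \<noteq> j" "i' \<noteq> j'" using eq by auto
    have img: "\<phi> ` {i, j} = {\<phi> i, \<phi> j}" "\<phi> ` {i', j'} = {\<phi> i, \<phi> j}" using eq by auto
    have "{\<phi> i, \<phi> j} \<in> \<Gamma>"
      using map ij(1) img(1) unfolding simplicial_map_def by metis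
    then have "{\<phi> i, \<phi> j} \<in> edges \<Gamma>" using False by (simp add: edges_def)
    moreover have "{i, j} \<in> edges \<Delta>" "{i', j'} \<in> edges \<Delta>"
      using ij ne by (auto simp: edges_def)
    ultimately obtain es where es: "es \<noteq> []" "hd es = {i, j}" "last es = {i', j'}"
      "set es \<subseteq> edges \<Delta>" "\<forall>e\<in>set es. \<phi> ` e = {\<phi> i, \<phi> j}"
      "successively (\<lambda>e e'. e \<union> e' \<in> \<Delta> \<and> e \<inter> e' \<noteq> {}) es"
      using edge_chain[rule_format, OF _ _ _ conjI[OF img]] by blast
    \<comment> \<open>The conditions on images orient the edge: \<open>k\<close> is the endpoint
      over \<open>\<phi> i\<close> and \<open>l\<close> the one over
      \<open>\<phi> j\<close>.\<close>
    define P where "P e \<longleftrightarrow> (\<forall>k l. k \<in> e \<and> l \<in> e \<and> \<phi> k = \<phi> i \<and> \<phi> l = \<phi> j \<longrightarrow> M k l = M i j)" for e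
    have "P (last es)"
    proof (rule successively_invariant[OF es(6,1)])
      show "P (hd es)" using False by (auto simp: P_def es(2))
      fix e e' assume e: "e \<in> set es" "e' \<in> set es" "P e"
        and R: "e \<union> e' \<in> \<Delta> \<and> e \<inter> e' \<noteq> {}"
      have "\<phi> ` e = {\<phi> i, \<phi> j}" using es(5) e(1) by blast
      then obtain k l where kl: "k \<in> e" "l \<in> e" "\<phi> k = \<phi> i" "\<phi> l = \<phi> j"
        by (metis imageE insertI1 insertI2 singletonI)
      show "P e'"
        unfolding P_def
      proof (intro allI impI, elim conjE)
        fix k' l' assume k'l': "k' \<in> e'" "l' \<in> e'" "\<phi> k' = \<phi> i" "\<phi> l' = \<phi> j"
        have down: "G \<in> \<Delta>" if "G \<subseteq> e \<union> e'" for G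
          using sc R that unfolding abstract_simplicial_complex_def by blast
        \<comment> \<open>The endpoints are exchanged one at a time; all triples involved lie in the
          face \<open>e \<union> e'\<close>.\<close>
        have "M k l = M k' l" by (rule step) (use kl k'l' in \<open>auto intro: down\<close>)
        moreover have "M l k' = M l' k'" by (rule step) (use kl k'l' in \<open>auto intro: down\<close>)
        ultimately show "M k' l' = M i j"
          using e(3) kl sym[of l k'] sym[of l' k'] unfolding P_def by metis
      qed
    qed
    then show ?thesis unfolding P_def es(3) using eq by simp
  qed
qed

text \<open>Surjectivity gives a face \<open>T\<close> over the support of \<open>w\<close>. A
  section \<open>s\<close> of \<open>\<phi>\<close> on \<open>T\<close> moves each coordinate of
  \<open>w\<close> to a single vertex of \<open>T\<close>.\<close>

lemma induced_map_lift:
  assumes sc: "abstract_simplicial_complex V \<Delta>" "abstract_simplicial_complex W \<Gamma>"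
    and surj: "surjective_simplicial_map V \<Delta> W \<Gamma> \<phi>" and w: "w \<in> coord_variety \<Gamma>"
  obtains v where "v \<in> coord_variety \<Delta>" "induced_map \<phi> v = w"
proof -
  have "Poly_Mapping.keys w \<in> \<Gamma>" using w coord_variety_iff[OF sc(2)] by simp
  then obtain T where T: "T \<in> \<Delta>" "Poly_Mapping.keys w = \<phi> ` T"
    using surj unfolding surjective_simplicial_map_def by blast
  have V: "finite V" "T \<subseteq> V" using sc(1) T(1) by (auto simp: abstract_simplicial_complex_def)
  define s where "s = inv_into T \<phi>"
  have s: "s c \<in> T" "\<phi> (s c) = c" if "c \<in> Poly_Mapping.keys w" for c
    using that by (auto simp: s_def T(2) inv_into_into f_inv_into_f)
  define v :: "'a \<Rightarrow>\<^sub>0 real" where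
    "v = (\<Sum>c\<in>Poly_Mapping.keys w. Poly_Mapping.single (s c) (Poly_Mapping.lookup w c))"
  have lv: "Poly_Mapping.lookup v k =
      (\<Sum>c\<in>Poly_Mapping.keys w. if s c = k then Poly_Mapping.lookup w c else 0)" for k
    by (simp add: v_def lookup_sum lookup_single when_def)
  have kv: "Poly_Mapping.keys v \<subseteq> T"
    using s(1) by (auto simp: in_keys_iff lv elim!: sum.not_neutral_contains_not_neutral split: if_splits)
  then have "v \<in> coord_variety \<Delta>"
    using T(1) sc(1) unfolding coord_variety_iff[OF sc(1)] abstract_simplicial_complex_def by blast
  moreover have "induced_map \<phi> v = w"
  proof (rule poly_mapping_eqI)
    fix d
    have "Poly_Mapping.lookup (induced_map \<phi> v) d = (\<Sum>k | k \<in> V \<and> \<phi> k = d. Poly_Mapping.lookup v k)"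
      by (rule lookup_induced_map[OF V(1) subset_trans[OF kv V(2)]])
    also have "\<dots> = (\<Sum>c\<in>Poly_Mapping.keys w. \<Sum>k | k \<in> V \<and> \<phi> k = d.
        if s c = k then Poly_Mapping.lookup w c else 0)"
      unfolding lv by (rule sum.swap)
    \<comment> \<open>Since \<open>s c\<close> lies in the fibre over \<open>c\<close>, the inner
      sum meets it exactly when \<open>c = d\<close>.\<close>
    also have "\<dots> = (\<Sum>c\<in>Poly_Mapping.keys w. if c = d then Poly_Mapping.lookup w c else 0)"
      by (rule sum.cong) (use V s in \<open>auto simp: sum.delta'\<close>)
    also have "\<dots> = Poly_Mapping.lookup w d" by (simp add: in_keys_iff)
    finally show "Poly_Mapping.lookup (induced_map \<phi> v) d = Poly_Mapping.lookup w d" .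
  qed
  ultimately show thesis by (rule that)
qed

lemma summand_of_pullback:
  assumes sc: "abstract_simplicial_complex V \<Delta>" "abstract_simplicial_complex W \<Gamma>"
    and conn: "strongly_connected V \<Delta> W \<Gamma> \<phi>"
    and a: "a \<in> P_cone V \<Delta>" and b: "b \<in> P_cone V \<Delta>" and f: "f \<in> R2 W \<Gamma>"
    and ab: "a \<oplus>\<^bsub>SR_ring V \<Delta>\<^esub> b = pullback V \<Delta> \<phi> f"
  shows "a \<in> pullback V \<Delta> \<phi> ` P_cone W \<Gamma>"
proof -
  have surj: "surjective_simplicial_map V \<Delta> W \<Gamma> \<phi>" and map: "simplicial_map V \<Delta> W \<Gamma> \<phi>"
    using conn by (simp_all add: strongly_connected_def surjective_simplicial_map_def)
  have fin: "finite V" "finite W" and \<phi>V: "\<phi> ` V \<subseteq> W"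
    using sc map by (simp_all add: abstract_simplicial_complex_def simplicial_map_def)
  have aR: "a \<in> R2 V \<Delta>" using a by (simp add: P_cone_def)
  obtain M where sym: "\<And>i j. M i j = M j i"
    and M: "\<And>v. v \<in> coord_variety \<Delta> \<Longrightarrow> SR_eval a v =
      (\<Sum>i\<in>V. \<Sum>j\<in>V. M i j * Poly_Mapping.lookup v i * Poly_Mapping.lookup v j)"
    using SR_eval_matrix[OF sc(1) aR] by blast
  have step: "M i j = M i' j" if "{i, i', j} \<in> \<Delta>" "\<phi> i = \<phi> i'" for i i' j
    using sc map a b f ab sym M that by (rule summand_entries_eq)
  have Meq: "M i j = M i' j'"
    if "{i, j} \<in> \<Delta>" "{i', j'} \<in> \<Delta>" "\<phi> i = \<phi> i'" "\<phi> j = \<phi> j'" for i j i' j'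
    using sc(1) conn sym step that by (rule strongly_connected_entries_eq)
  \<comment> \<open>The choice is unambiguous by \<open>Meq\<close> whenever \<open>(c, d)\<close>
    comes from a pair in a face, \<open>i = j\<close> included. Any other entry is
    arbitrary.\<close>
  define N where
    "N c d = (SOME x. \<exists>i j. {i, j} \<in> \<Delta> \<and> \<phi> i = c \<and> \<phi> j = d \<and> x = M i j)" for c d
  have N: "N (\<phi> i) (\<phi> j) = M i j" if "{i, j} \<in> \<Delta>" for i j
    unfolding N_def by (rule some_equality) (use that Meq in blast)+
  obtain g where g: "g \<in> R2 W \<Gamma>"
    and gN: "\<And>w. w \<in> coord_variety \<Gamma> \<Longrightarrow> SR_eval g w =
      (\<Sum>c\<in>W. \<Sum>d\<in>W. N c d * Poly_Mapping.lookup w c * Poly_Mapping.lookup w d)"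
    using matrix_R2[OF sc(2)] by blast
  have ga: "SR_eval a v = SR_eval g (induced_map \<phi> v)" if v: "v \<in> coord_variety \<Delta>" for v
  proof -
    let ?v = "Poly_Mapping.lookup v" and ?w = "Poly_Mapping.lookup (induced_map \<phi> v)"
    have kv: "Poly_Mapping.keys v \<in> \<Delta>" using v coord_variety_iff[OF sc(1)] by simp
    then have kV: "Poly_Mapping.keys v \<subseteq> V"
      using sc(1) by (auto simp: abstract_simplicial_complex_def)
    \<comment> \<open>Grouping \<open>V\<close> into fibres turns a pairing over \<open>W\<close>
      into one over \<open>V\<close>; it is applied to both indices of the form.\<close>
    have lin: "(\<Sum>c\<in>W. h c * ?w c) = (\<Sum>i\<in>V. h (\<phi> i) * ?v i)" for h
    proof -
      have "(\<Sum>c\<in>W. h c * ?w c) = (\<Sum>c\<in>W. \<Sum>i | i \<in> V \<and> \<phi> i = c. h (\<phi> i) * ?v i)"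
        unfolding lookup_induced_map[OF fin(1) kV] sum_distrib_left by (intro sum.cong) auto
      also have "\<dots> = (\<Sum>i\<in>V. h (\<phi> i) * ?v i)" by (rule sum.group[OF fin \<phi>V])
      finally show ?thesis .
    qed
    \<comment> \<open>For a pair outside \<open>\<Delta>\<close> the entries of \<open>M\<close> and
      \<open>N\<close> may differ, but then one of the two coordinates of \<open>v\<close> is
      0.\<close>
    have MN: "M i j * ?v i * ?v j = N (\<phi> i) (\<phi> j) * ?v i * ?v j" for i j
    proof (cases "?v i = 0 \<or> ?v j = 0")
      case False
      then have "{i, j} \<subseteq> Poly_Mapping.keys v" by (simp add: in_keys_iff)
      then have "{i, j} \<in> \<Delta>" using kv sc(1) unfolding abstract_simplicial_complex_def by blast
      then show ?thesis by (simp add: N)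
    qed auto
    have "SR_eval g (induced_map \<phi> v) = (\<Sum>c\<in>W. (\<Sum>d\<in>W. N c d * ?w d) * ?w c)"
      unfolding gN[OF induced_map_coord_variety[OF sc map v]] sum_distrib_right
      by (simp add: mult_ac)
    also have "\<dots> = (\<Sum>i\<in>V. (\<Sum>j\<in>V. N (\<phi> i) (\<phi> j) * ?v j) * ?v i)"
      unfolding lin ..
    also have "\<dots> = (\<Sum>i\<in>V. \<Sum>j\<in>V. N (\<phi> i) (\<phi> j) * ?v i * ?v j)"
      unfolding sum_distrib_right by (simp add: mult_ac)
    finally show ?thesis by (simp add: M[OF v] MN)
  qed
  \<comment> \<open>At a lift \<open>v\<close> of \<open>w\<close> the value of \<open>g\<close> is
    that of \<open>a\<close>, which is nonnegative.\<close>
  have "0 \<le> SR_eval g w" if "w \<in> coord_variety \<Gamma>" for w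
    using induced_map_lift[OF sc surj that] ga a unfolding P_cone_def
    by (metis (mono_tags, lifting) mem_Collect_eq)
  then have "g \<in> P_cone W \<Gamma>" using g by (simp add: P_cone_def)
  moreover have "pullback V \<Delta> \<phi> g = a"
    by (rule pullback_eqI[OF sc map g aR ga])
  ultimately show ?thesis by blast
qed

theorem theorem3p9:
  fixes V :: "'a set" and \<Delta> :: "'a set set"
    and W :: "'b set" and \<Gamma> :: "'b set set"
    and \<phi> :: "'a \<Rightarrow> 'b"
  assumes "abstract_simplicial_complex V \<Delta>" and "abstract_simplicial_complex W \<Gamma>"
    and "strongly_connected V \<Delta> W \<Gamma> \<phi>"
  shows "cone_face V \<Delta> (pullback V \<Delta> \<phi> ` P_cone W \<Gamma>) (P_cone V \<Delta>)"
proof -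
  have map: "simplicial_map V \<Delta> W \<Gamma> \<phi>"
    using assms(3) by (simp add: strongly_connected_def surjective_simplicial_map_def)
  have "a \<in> pullback V \<Delta> \<phi> ` P_cone W \<Gamma> \<and> b \<in> pullback V \<Delta> \<phi> ` P_cone W \<Gamma>"
    if ab: "a \<in> P_cone V \<Delta>" "b \<in> P_cone V \<Delta>"
      and sum: "a \<oplus>\<^bsub>SR_ring V \<Delta>\<^esub> b \<in> pullback V \<Delta> \<phi> ` P_cone W \<Gamma>" for a b
  proof -
    obtain f where f: "f \<in> R2 W \<Gamma>" "a \<oplus>\<^bsub>SR_ring V \<Delta>\<^esub> b = pullback V \<Delta> \<phi> f"
      using sum by (auto simp: P_cone_def)
    \<comment> \<open>\<open>summand_of_pullback\<close> speaks of the first summand only, so the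
      sum is commuted to treat \<open>b\<close>.\<close>
    have "b \<oplus>\<^bsub>SR_ring V \<Delta>\<^esub> a = pullback V \<Delta> \<phi> f"
    proof -
      obtain p q where "p \<in> carrier (mpoly_ring V)" "q \<in> carrier (mpoly_ring V)"
        "a = SR_class V \<Delta> p" "b = SR_class V \<Delta> q"
        using ab unfolding P_cone_def R2_def by blast
      then show ?thesis using f(2) by (simp add: SR_class_add[OF assms(1)] add.commute)
    qed
    then show ?thesis
      using summand_of_pullback[OF assms ab f] summand_of_pullback[OF assms ab(2,1) f(1)] by blast
  qed
  then show ?thesis
    unfolding cone_face_def
    using P_cone_convex_cone[OF assms(1)] pullback_P_cone[OF assms(1,2) map]
      pullback_image_convex_cone[OF assms(1,2) map] by blast
qed

end
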